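(* Let $s=1$ and $a\in\mathbb{Z}_p$, and let $l\in\{0,1,\dots,p-1\}$ be the unique integer with $a+l\equiv0\pmod p$. If $p$ is odd, then $$\mathscr{F}^{\rm Dw}_a(t)=(-t)^l\,\mathscr{F}^{\rm Dw}_a(t^{-1}).$$ If $p=2$, then $\mathscr{F}^{\rm Dw}_a(t)=\pm(-t)^l\,\mathscr{F}^{\rm Dw}_a(t^{-1})$ for a suitable sign; in particular for $p=2$ and $a=1$ one has $\mathscr{F}^{\rm Dw}_1(t)=-(-t)\mathscr{F}^{\rm Dw}_1(t^{-1})\neq(-t)\mathscr{F}^{\rm Dw}_1(t^{-1})$.
   Context: For $b\in\mathbb{Z}_p$ the Dwork prime is $b'=(b+l_b)/p$ with $l_b\in\{0,\dots,p-1\}$, $b+l_b\equiv0\pmod p$. For $s=1$, $F_b(t)=\sum_{k\ge0}\frac{(b)_k}{k!}t^k=(1-t)^{-b}\in\mathbb{Z}_p[[t]]$, and Dwork's $p$-adic hypergeometric function is $\mathscr{F}^{\rm Dw}_b(t)=F_b(t)/F_{b'}(t^p)$. For a power series $f=\sum a_it^i$ write $f(t)_{<m}=\sum_{i<m}a_it^i$. By Dwork's congruence, $\mathscr{F}^{\rm Dw}_b(t)\equiv F_b(t)_{<p^n}/F_{b'}(t^p)_{<p^n}\pmod{p^n}$ for all $n$, so $\mathscr{F}^{\rm Dw}_b(t)$ is a $p$-adic limit of rational functions; $\mathscr{F}^{\rm Dw}_b(t^{-1})$ denotes the element obtained by substituting $t^{-1}$ for $t$ in these rational functions and passing to the $p$-adic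 limit, and the identities are understood in the $p$-adic completion of the ring of rational functions in $t$ over $\mathbb{Z}_p$ in which these limits live. *)

theory Defs
  imports
    "HOL-Computational_Algebra.Computational_Algebra"
    "Berlekamp_Zassenhaus.Finite_Field"
begin


section \<open>The ring of p-adic integers\<close>

text \<open>
  The prime is p = CARD('p) for a type 'p of class prime_card.  A p-adic integer is a point of
  the projective limit of the rings of residues modulo p^n; residues are represented by
  their least nonnegative representatives, so x n lies in {0..<p^n}.
\<close>

typedef (overloaded) ('p::prime_card) padic_int =
  "{x :: nat \<Rightarrow> int. \<forall>n. x n = x (Suc n) mod int CARD('p) ^ n}"
  by (rule exI[of _ "\<lambda>_. 0"]) simp

setup_lifting type_definition_padic_int

lemma padic_coherent:
  fixes x :: "nat \<Rightarrow> int"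
  assumes "\<forall>n. x n = x (Suc n) mod q ^ n"
  shows "x (n + k) mod q ^ n = x n"
proof (induction k)
  case 0
  show ?case using assms by (metis add_0_right mod_mod_trivial)
next
  case (Suc k)
  have "x (n + k) mod q ^ n = x (Suc (n + k)) mod q ^ (n + k) mod q ^ n"
    using assms by metis
  also have "\<dots> = x (n + Suc k) mod q ^ n"
    by (simp add: mod_mod_cancel le_imp_power_dvd)
  finally show ?case using Suc by simp
qed

lemma mod_power_Suc: "(a::int) mod q ^ Suc n mod q ^ n = a mod q ^ n"
  by (simp add: mod_mod_cancel)

lemma coherent_add:
  fixes x y :: "nat \<Rightarrow> int"
  assumes "\<And>n. x n = x (Suc n) mod q ^ n" "\<And>n. y n = y (Suc n) mod q ^ n"
  shows "(x n + y n) mod q ^ n = (x (Suc n) + y (Suc n)) mod q ^ Suc n mod q ^ n"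
proof -
  have "(x n + y n) mod q ^ n = (x (Suc n) mod q ^ n + y (Suc n) mod q ^ n) mod q ^ n"
    by (simp only: assms(1)[of n, symmetric] assms(2)[of n, symmetric])
  then show "(x n + y n) mod q ^ n = (x (Suc n) + y (Suc n)) mod q ^ Suc n mod q ^ n"
    by (simp only: mod_power_Suc mod_add_eq)
qed

lemma coherent_diff:
  fixes x y :: "nat \<Rightarrow> int"
  assumes "\<And>n. x n = x (Suc n) mod q ^ n" "\<And>n. y n = y (Suc n) mod q ^ n"
  shows "(x n - y n) mod q ^ n = (x (Suc n) - y (Suc n)) mod q ^ Suc n mod q ^ n"
proof -
  have "(x n - y n) mod q ^ n = (x (Suc n) mod q ^ n - y (Suc n) mod q ^ n) mod q ^ n"
    by (simp only: assms(1)[of n, symmetric] assms(2)[of n, symmetric])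
  then show "(x n - y n) mod q ^ n = (x (Suc n) - y (Suc n)) mod q ^ Suc n mod q ^ n"
    by (simp only: mod_power_Suc mod_diff_eq)
qed

lemma coherent_mult:
  fixes x y :: "nat \<Rightarrow> int"
  assumes "\<And>n. x n = x (Suc n) mod q ^ n" "\<And>n. y n = y (Suc n) mod q ^ n"
  shows "(x n * y n) mod q ^ n = (x (Suc n) * y (Suc n)) mod q ^ Suc n mod q ^ n"
proof -
  have "(x n * y n) mod q ^ n = ((x (Suc n) mod q ^ n) * (y (Suc n) mod q ^ n)) mod q ^ n"
    by (simp only: assms(1)[of n, symmetric] assms(2)[of n, symmetric])
  then show "(x n * y n) mod q ^ n = (x (Suc n) * y (Suc n)) mod q ^ Suc n mod q ^ n"
    by (simp only: mod_power_Suc mod_mult_eq)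
qed

lemma padic_residue_Suc:
  "Rep_padic_int (x :: 'p::prime_card padic_int) n =
     Rep_padic_int x (Suc n) mod int CARD('p) ^ n"
  using Rep_padic_int[of x] by blast

lemma padic_bounds:
  "0 \<le> Rep_padic_int (x :: 'p::prime_card padic_int) n"
  "Rep_padic_int x n < int CARD('p) ^ n"
proof -
  have p: "0 < int CARD('p) ^ n" by (simp add: prime_gt_0_nat[OF prime_card])
  have "Rep_padic_int x n = Rep_padic_int x (Suc n) mod int CARD('p) ^ n"
    by (rule padic_residue_Suc)
  then show "0 \<le> Rep_padic_int x n" "Rep_padic_int x n < int CARD('p) ^ n"
    using p by (metis pos_mod_sign, metis pos_mod_bound)
qed

lemma padic_mod:
  "Rep_padic_int (x :: 'p::prime_card padic_int) n mod int CARD('p) ^ n = Rep_padic_int x n"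
  by (intro mod_pos_pos_trivial padic_bounds)

lemma padic_mod_le:
  assumes "n \<le> m"
  shows "Rep_padic_int (x :: 'p::prime_card padic_int) m mod int CARD('p) ^ n = Rep_padic_int x n"
  using padic_coherent[of "Rep_padic_int x" "int CARD('p)" n "m - n"] padic_residue_Suc[of x] assms
  unfolding le_add_diff_inverse[OF assms] by blast

lemma padic_eqI: "(\<And>n. Rep_padic_int x n = Rep_padic_int y n) \<Longrightarrow> x = y"
  by (metis Rep_padic_int_inject ext)

instantiation padic_int :: (prime_card) comm_ring_1
begin

lift_definition zero_padic_int :: "'a padic_int" is "\<lambda>_. 0" by simp

lift_definition one_padic_int :: "'a padic_int" is "\<lambda>n. 1 mod int CARD('a) ^ n"
  by (simp add: mod_power_Suc del: power_Suc)

lift_definition plus_padic_int :: "'a padic_int \<Rightarrow> 'a padic_int \<Rightarrow> 'a padic_int"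
  is "\<lambda>x y n. (x n + y n) mod int CARD('a) ^ n"
  by (rule coherent_add)

lift_definition minus_padic_int :: "'a padic_int \<Rightarrow> 'a padic_int \<Rightarrow> 'a padic_int"
  is "\<lambda>x y n. (x n - y n) mod int CARD('a) ^ n"
  by (rule coherent_diff)

lift_definition uminus_padic_int :: "'a padic_int \<Rightarrow> 'a padic_int"
  is "\<lambda>x n. (0 - x n) mod int CARD('a) ^ n"
  by (rule coherent_diff[of "\<lambda>_. 0"]) simp

lift_definition times_padic_int :: "'a padic_int \<Rightarrow> 'a padic_int \<Rightarrow> 'a padic_int"
  is "\<lambda>x y n. (x n * y n) mod int CARD('a) ^ n"
  by (rule coherent_mult)

instance
proof
  fix a b c :: "'a padic_int"
  note rep = times_padic_int.rep_eq plus_padic_int.rep_eq uminus_padic_int.rep_eq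
    minus_padic_int.rep_eq zero_padic_int.rep_eq one_padic_int.rep_eq
  show "a * b * c = a * (b * c)"
    by (rule padic_eqI) (simp add: rep mod_simps mult.assoc)
  show "a * b = b * a"
    by (rule padic_eqI) (simp add: rep mult.commute)
  show "1 * a = a"
    by (simp add: padic_eqI times_padic_int.rep_eq one_padic_int.rep_eq mod_simps padic_mod)
  show "(a + b) * c = a * c + b * c"
    by (rule padic_eqI) (simp add: rep mod_simps distrib_right)
  show "a + b + c = a + (b + c)"
    by (rule padic_eqI) (simp add: rep mod_simps add.assoc)
  show "a + b = b + a"
    by (rule padic_eqI) (simp add: rep add.commute)
  show "0 + a = a"
    by (simp add: padic_eqI plus_padic_int.rep_eq zero_padic_int.rep_eq padic_mod)
  show "- a + a = 0"
    by (rule padic_eqI) (simp add: rep mod_simps)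
  show "a - b = a + - b"
    by (rule padic_eqI) (simp add: rep mod_simps)
  have "Rep_padic_int (0::'a padic_int) 1 \<noteq> Rep_padic_int 1 1"
    using prime_gt_1_nat[OF prime_card[where 'a='a]]
    by (simp add: zero_padic_int.rep_eq one_padic_int.rep_eq)
  then show "(0::'a padic_int) \<noteq> 1" by metis
qed

end

lemma padic_of_nat:
  "Rep_padic_int (of_nat k :: 'p::prime_card padic_int) n = int k mod int CARD('p) ^ n"
  by (induction k)
    (simp_all add: zero_padic_int.rep_eq one_padic_int.rep_eq plus_padic_int.rep_eq mod_simps)

lemma padic_eq_0_iff: "x = 0 \<longleftrightarrow> (\<forall>n. Rep_padic_int x n = 0)"
  by (auto simp: zero_padic_int.rep_eq Rep_padic_int_inject[symmetric])

lemma padic_power_dvd_residue: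
  assumes "Rep_padic_int (x :: 'p::prime_card padic_int) n \<noteq> 0" "n \<le> m"
  shows "\<not> int CARD('p) ^ n dvd Rep_padic_int x m"
  using assms padic_mod_le[OF assms(2), of x] by auto

instance padic_int :: (prime_card) idom
proof
  fix a b :: "'a padic_int"
  let ?p = "int CARD('a)"
  assume "a \<noteq> 0" "b \<noteq> 0"
  then obtain m n where mn: "Rep_padic_int a m \<noteq> 0" "Rep_padic_int b n \<noteq> 0"
    by (auto simp: padic_eq_0_iff)
  let ?a = "Rep_padic_int a (m + n)" and ?b = "Rep_padic_int b (m + n)"
  have nd: "\<not> ?p ^ m dvd ?a" "\<not> ?p ^ n dvd ?b"
    using padic_power_dvd_residue mn by (metis le_add1, metis le_add2)
  have pp: "prime_elem ?p" using prime_card_int[where 'a='a] by simp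
  have "\<not> ?p ^ (m + n) dvd ?a * ?b"
  proof
    assume d: "?p ^ (m + n) dvd ?a * ?b"
    have nz: "?a \<noteq> 0" "?b \<noteq> 0" using nd by auto
    have u: "\<not> is_unit ?p" using pp by auto
    have "m + n \<le> multiplicity ?p (?a * ?b)"
      using d nz u by (intro multiplicity_geI) auto
    also have "\<dots> = multiplicity ?p ?a + multiplicity ?p ?b"
      using nz pp by (intro prime_elem_multiplicity_mult_distrib) auto
    also have "multiplicity ?p ?a < m" "multiplicity ?p ?b < n"
      using nd nz u by (auto intro!: multiplicity_lessI)
    ultimately show False by linarith
  qed
  then have "Rep_padic_int (a * b) (m + n) \<noteq> 0"
    by (simp add: times_padic_int.rep_eq dvd_eq_mod_eq_0)
  then show "a * b \<noteq> 0" by (auto simp: padic_eq_0_iff)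
qed

instance padic_int :: (prime_card) ring_char_0
proof
  show "inj (of_nat :: nat \<Rightarrow> 'a padic_int)"
  proof (rule injI)
    fix i j assume eq: "(of_nat i :: 'a padic_int) = of_nat j"
    define n where "n = i + j"
    have "n < CARD('a) ^ n"
      using prime_gt_1_nat[OF prime_card[where 'a='a]] by (intro power_gt_expt) auto
    then have "int n < int CARD('a) ^ n" by (metis of_nat_less_iff of_nat_power)
    moreover have "int i \<le> int n" "int j \<le> int n" by (simp_all add: n_def)
    ultimately have "int i < int CARD('a) ^ n" "int j < int CARD('a) ^ n" by linarith+
    then have "int i mod int CARD('a) ^ n = int i" "int j mod int CARD('a) ^ n = int j"
      by simp_all
    then show "i = j"
      using arg_cong[OF eq, of "\<lambda>x. Rep_padic_int x n"] by (simp add: padic_of_nat)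
  qed
qed

text \<open>Exact division; the quotient is 0 when it does not exist in the ring.\<close>

instantiation padic_int :: (prime_card) idom_divide
begin

definition divide_padic_int :: "'a padic_int \<Rightarrow> 'a padic_int \<Rightarrow> 'a padic_int" where
  "divide_padic_int x y = (if y \<noteq> 0 \<and> y dvd x then THE z. x = y * z else 0)"

instance
proof
  fix a b :: "'a padic_int"
  assume "b \<noteq> 0"
  then show "a * b div b = a"
    by (auto simp: divide_padic_int_def mult.commute)
qed (simp add: divide_padic_int_def)

end

lemma padic_dvd_iff:
  "of_nat CARD('p) dvd (x :: 'p::prime_card padic_int) \<longleftrightarrow> Rep_padic_int x 1 = 0"
proof
  assume "of_nat CARD('p) dvd x"
  then obtain y where "x = of_nat CARD('p) * y" by (elim dvdE)
  then show "Rep_padic_int x 1 = 0"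
    by (simp add: times_padic_int.rep_eq padic_of_nat)
next
  let ?p = "int CARD('p)" and ?x = "Rep_padic_int x"
  have p0: "0 < ?p" using prime_gt_0_nat[OF prime_card[where 'a='p]] by simp
  assume x1: "?x 1 = 0"
  have dv: "?p dvd ?x (Suc n)" for n
    using padic_mod_le[of 1 "Suc n" x] x1 by auto
  define y where "y = (\<lambda>n. ?x (Suc n) div ?p)"
  have py: "?p * y n = ?x (Suc n)" for n
    using dv by (simp add: y_def)
  have coh: "y n = y (Suc n) mod ?p ^ n" for n
  proof -
    have "?p * (y (Suc n) mod ?p ^ n) = (?p * y (Suc n)) mod (?p * ?p ^ n)"
      by (rule mult_mod_right)
    also have "\<dots> = ?x (Suc n)"
      using padic_mod_le[of "Suc n" "Suc (Suc n)" x] by (simp add: py)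
    also have "\<dots> = ?p * y n" by (simp add: py)
    finally show ?thesis using p0 by simp
  qed
  define z :: "'p padic_int" where "z = Abs_padic_int y"
  have rz: "Rep_padic_int z = y"
    unfolding z_def by (rule Abs_padic_int_inverse, unfold mem_Collect_eq, rule allI, rule coh)
  have "Rep_padic_int (of_nat CARD('p) * z) n = ?x n" for n
    using padic_mod_le[of n "Suc n" x]
    by (simp add: times_padic_int.rep_eq padic_of_nat rz mod_simps py)
  then have "of_nat CARD('p) * z = x"
    by (metis Rep_padic_int_inject ext)
  then show "of_nat CARD('p) dvd x" by (metis dvd_triv_left)
qed

lemma prime_elem_padic: "prime_elem (of_nat CARD('p) :: 'p::prime_card padic_int)"
proof (rule prime_elemI)
  let ?p = "of_nat CARD('p) :: 'p padic_int"
  have p: "prime (int CARD('p))" by (rule prime_card_int)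
  show "?p \<noteq> 0" using prime_gt_0_nat[OF prime_card[where 'a='p]] by simp
  show "\<not> ?p dvd 1"
    using prime_gt_1_nat[OF prime_card[where 'a='p]]
    by (simp add: padic_dvd_iff one_padic_int.rep_eq)
  fix a b assume "?p dvd a * b"
  then have "int CARD('p) dvd Rep_padic_int a 1 * Rep_padic_int b 1"
    by (simp add: padic_dvd_iff times_padic_int.rep_eq dvd_eq_mod_eq_0)
  then have "int CARD('p) dvd Rep_padic_int a 1 \<or> int CARD('p) dvd Rep_padic_int b 1"
    using p prime_dvd_mult_iff by blast
  then show "?p dvd a \<or> ?p dvd b"
    using padic_mod[of a 1] padic_mod[of b 1] by (auto simp: padic_dvd_iff)
qed


section \<open>The p-adic completion of the ring of rational functions\<close>

type_synonym 'p ratfun = "'p padic_int poly fract"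

text \<open>
  The localization of the polynomial ring over the p-adic integers at the prime ideal
  generated by p: all fractions whose denominator is nonzero modulo p.
\<close>

definition ratfun_ring :: "'p::prime_card ratfun set" where
  "ratfun_ring = {Fract f g | f g. \<not> of_nat CARD('p) dvd g}"

text \<open>Divisibility by p^k inside this ring (the ambient type is its field of fractions).\<close>

definition ratfun_pdvd :: "nat \<Rightarrow> 'p::prime_card ratfun \<Rightarrow> bool" where
  "ratfun_pdvd k x \<longleftrightarrow> (\<exists>r\<in>ratfun_ring. x = of_nat CARD('p) ^ k * r)"

definition ratfun_Cauchy :: "(nat \<Rightarrow> 'p::prime_card ratfun) \<Rightarrow> bool" where
  "ratfun_Cauchy X \<longleftrightarrow> (\<forall>n. X n \<in> ratfun_ring) \<and>
     (\<forall>k. \<exists>N. \<forall>m\<ge>N. \<forall>n\<ge>N. ratfun_pdvd k (X m - X n))"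

definition ratfun_rel :: "(nat \<Rightarrow> 'p::prime_card ratfun) \<Rightarrow> (nat \<Rightarrow> 'p ratfun) \<Rightarrow> bool" where
  "ratfun_rel X Y \<longleftrightarrow> ratfun_Cauchy X \<and> ratfun_Cauchy Y \<and>
     (\<forall>k. \<exists>N. \<forall>n\<ge>N. ratfun_pdvd k (X n - Y n))"

lemma prime_elem_padic_poly:
  "prime_elem (of_nat CARD('p) :: 'p::prime_card padic_int poly)"
  using lift_prime_elem_poly[OF prime_elem_padic[where 'p='p]] by (simp add: of_nat_poly)

lemma ratfun_ring_cases:
  assumes "x \<in> ratfun_ring"
  obtains f g where "x = Fract f g" "\<not> of_nat CARD('p) dvd (g :: 'p::prime_card padic_int poly)"
    "g \<noteq> 0"
  using assms by (auto simp: ratfun_ring_def)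

lemma ratfun_ringI:
  "\<not> of_nat CARD('p) dvd (g :: 'p::prime_card padic_int poly) \<Longrightarrow> Fract f g \<in> ratfun_ring"
  by (auto simp: ratfun_ring_def)

lemma ratfun_ring_add:
  assumes "x \<in> ratfun_ring" "y \<in> ratfun_ring"
  shows "x + y \<in> (ratfun_ring :: 'p::prime_card ratfun set)"
  using assms prime_elem_dvd_mult_iff[OF prime_elem_padic_poly[where 'p='p]]
  by (elim ratfun_ring_cases) (auto intro!: ratfun_ringI)

lemma ratfun_ring_mult:
  assumes "x \<in> ratfun_ring" "y \<in> ratfun_ring"
  shows "x * y \<in> (ratfun_ring :: 'p::prime_card ratfun set)"
  using assms prime_elem_dvd_mult_iff[OF prime_elem_padic_poly[where 'p='p]]
  by (elim ratfun_ring_cases) (auto intro!: ratfun_ringI)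

lemma ratfun_ring_uminus: "x \<in> ratfun_ring \<Longrightarrow> - x \<in> ratfun_ring"
  by (elim ratfun_ring_cases) (auto intro!: ratfun_ringI)

lemma ratfun_ring_poly: "Fract f 1 \<in> (ratfun_ring :: 'p::prime_card ratfun set)"
  using prime_elem_not_unit[OF prime_elem_padic_poly[where 'p='p]]
  by (intro ratfun_ringI)

lemma ratfun_ring_0: "0 \<in> ratfun_ring" and ratfun_ring_1: "1 \<in> ratfun_ring"
  using ratfun_ring_poly[of 0] ratfun_ring_poly[of 1] by (simp_all add: fract_collapse)

lemma ratfun_ring_diff:
  "x \<in> ratfun_ring \<Longrightarrow> y \<in> ratfun_ring \<Longrightarrow> x - y \<in> ratfun_ring"
  using ratfun_ring_add[of x "- y"] ratfun_ring_uminus[of y] by simp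

lemma ratfun_pdvd_0: "ratfun_pdvd k 0"
  unfolding ratfun_pdvd_def by (rule bexI[of _ 0]) (simp_all add: ratfun_ring_0)

lemma ratfun_pdvd_add: "ratfun_pdvd k x \<Longrightarrow> ratfun_pdvd k y \<Longrightarrow> ratfun_pdvd k (x + y)"
  unfolding ratfun_pdvd_def by (metis distrib_left ratfun_ring_add)

lemma ratfun_pdvd_uminus: "ratfun_pdvd k x \<Longrightarrow> ratfun_pdvd k (- x)"
  unfolding ratfun_pdvd_def by (metis mult_minus_right ratfun_ring_uminus)

lemma ratfun_pdvd_mult: "ratfun_pdvd k x \<Longrightarrow> y \<in> ratfun_ring \<Longrightarrow> ratfun_pdvd k (x * y)"
  unfolding ratfun_pdvd_def by (metis mult.assoc ratfun_ring_mult)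

lemma ratfun_pdvd_mult': "ratfun_pdvd k x \<Longrightarrow> y \<in> ratfun_ring \<Longrightarrow> ratfun_pdvd k (y * x)"
  using ratfun_pdvd_mult by (simp add: mult.commute)

lemma ratfun_Cauchy_const: "x \<in> ratfun_ring \<Longrightarrow> ratfun_Cauchy (\<lambda>_. x)"
  by (simp add: ratfun_Cauchy_def ratfun_pdvd_0)

lemma ratfun_Cauchy_uminus:
  assumes "ratfun_Cauchy X"
  shows "ratfun_Cauchy (\<lambda>n. - X n)"
proof -
  have "- X m - - X n = - (X m - X n)" for m n by simp
  with assms show ?thesis
    unfolding ratfun_Cauchy_def by (metis ratfun_pdvd_uminus ratfun_ring_uminus)
qed

lemma ratfun_Cauchy_add:
  assumes "ratfun_Cauchy X" "ratfun_Cauchy Y"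
  shows "ratfun_Cauchy (\<lambda>n. X n + Y n)"
  unfolding ratfun_Cauchy_def
proof (intro conjI allI)
  show "X n + Y n \<in> ratfun_ring" for n
    using assms by (simp add: ratfun_Cauchy_def ratfun_ring_add)
  fix k
  obtain N M where
    N: "\<And>m n. m \<ge> N \<Longrightarrow> n \<ge> N \<Longrightarrow> ratfun_pdvd k (X m - X n)" and
    M: "\<And>m n. m \<ge> M \<Longrightarrow> n \<ge> M \<Longrightarrow> ratfun_pdvd k (Y m - Y n)"
    using assms unfolding ratfun_Cauchy_def by metis
  have eq: "X m + Y m - (X n + Y n) = (X m - X n) + (Y m - Y n)" for m n by simp
  show "\<exists>N. \<forall>m\<ge>N. \<forall>n\<ge>N. ratfun_pdvd k (X m + Y m - (X n + Y n))"
    using N M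
    by (intro exI[of _ "max N M"] allI impI) (subst eq, rule ratfun_pdvd_add, auto)
qed

lemma ratfun_Cauchy_mult:
  assumes "ratfun_Cauchy X" "ratfun_Cauchy Y"
  shows "ratfun_Cauchy (\<lambda>n. X n * Y n)"
  unfolding ratfun_Cauchy_def
proof (intro conjI allI)
  have R: "X n \<in> ratfun_ring" "Y n \<in> ratfun_ring" for n
    using assms by (simp_all add: ratfun_Cauchy_def)
  then show "X n * Y n \<in> ratfun_ring" for n by (simp add: ratfun_ring_mult)
  fix k
  obtain N M where
    N: "\<And>m n. m \<ge> N \<Longrightarrow> n \<ge> N \<Longrightarrow> ratfun_pdvd k (X m - X n)" and
    M: "\<And>m n. m \<ge> M \<Longrightarrow> n \<ge> M \<Longrightarrow> ratfun_pdvd k (Y m - Y n)"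
    using assms unfolding ratfun_Cauchy_def by metis
  have "X m * Y m - X n * Y n = (X m - X n) * Y m + X n * (Y m - Y n)" for m n
    by (simp add: algebra_simps)
  then show "\<exists>N. \<forall>m\<ge>N. \<forall>n\<ge>N. ratfun_pdvd k (X m * Y m - X n * Y n)"
    using N M R
    by (intro exI[of _ "max N M"]) (simp add: ratfun_pdvd_add ratfun_pdvd_mult ratfun_pdvd_mult')
qed

lemma ratfun_rel_refl: "ratfun_rel X X \<longleftrightarrow> ratfun_Cauchy X"
  by (auto simp: ratfun_rel_def ratfun_pdvd_0)

lemma ratfun_rel_sym: "ratfun_rel X Y \<Longrightarrow> ratfun_rel Y X"
  unfolding ratfun_rel_def by (metis ratfun_pdvd_uminus minus_diff_eq)

lemma ratfun_rel_trans:
  assumes "ratfun_rel X Y" "ratfun_rel Y Z"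
  shows "ratfun_rel X Z"
  unfolding ratfun_rel_def
proof (intro conjI allI)
  show "ratfun_Cauchy X" "ratfun_Cauchy Z" using assms by (simp_all add: ratfun_rel_def)
  fix k
  obtain N M where "\<And>n. n \<ge> N \<Longrightarrow> ratfun_pdvd k (X n - Y n)" "\<And>n. n \<ge> M \<Longrightarrow> ratfun_pdvd k (Y n - Z n)"
    using assms unfolding ratfun_rel_def by metis
  then have "ratfun_pdvd k (X n - Z n)" if "n \<ge> max N M" for n
    using that ratfun_pdvd_add[of k "X n - Y n" "Y n - Z n"] by simp
  then show "\<exists>N. \<forall>n\<ge>N. ratfun_pdvd k (X n - Z n)" by blast
qed

lemma ratfun_rel_add:
  assumes "ratfun_rel X X'" "ratfun_rel Y Y'"
  shows "ratfun_rel (\<lambda>n. X n + Y n) (\<lambda>n. X' n + Y' n)"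
  unfolding ratfun_rel_def
proof (intro conjI allI)
  show "ratfun_Cauchy (\<lambda>n. X n + Y n)" "ratfun_Cauchy (\<lambda>n. X' n + Y' n)"
    using assms by (simp_all add: ratfun_rel_def ratfun_Cauchy_add)
  fix k
  obtain N M where
    NM: "\<And>n. n \<ge> N \<Longrightarrow> ratfun_pdvd k (X n - X' n)" "\<And>n. n \<ge> M \<Longrightarrow> ratfun_pdvd k (Y n - Y' n)"
    using assms unfolding ratfun_rel_def by metis
  have eq: "X n + Y n - (X' n + Y' n) = (X n - X' n) + (Y n - Y' n)" for n by simp
  show "\<exists>N. \<forall>n\<ge>N. ratfun_pdvd k (X n + Y n - (X' n + Y' n))"
    using NM
    by (intro exI[of _ "max N M"] allI impI) (subst eq, rule ratfun_pdvd_add, auto)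
qed

lemma ratfun_rel_uminus:
  assumes "ratfun_rel X X'"
  shows "ratfun_rel (\<lambda>n. - X n) (\<lambda>n. - X' n)"
proof -
  have "- X n - - X' n = - (X n - X' n)" for n by simp
  with assms show ?thesis
    unfolding ratfun_rel_def by (metis ratfun_Cauchy_uminus ratfun_pdvd_uminus)
qed

lemma ratfun_rel_mult:
  assumes "ratfun_rel X X'" "ratfun_rel Y Y'"
  shows "ratfun_rel (\<lambda>n. X n * Y n) (\<lambda>n. X' n * Y' n)"
  unfolding ratfun_rel_def
proof (intro conjI allI)
  show "ratfun_Cauchy (\<lambda>n. X n * Y n)" "ratfun_Cauchy (\<lambda>n. X' n * Y' n)"
    using assms by (simp_all add: ratfun_rel_def ratfun_Cauchy_mult)
  have R: "Y n \<in> ratfun_ring" "X' n \<in> ratfun_ring" for n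
    using assms by (simp_all add: ratfun_rel_def ratfun_Cauchy_def)
  fix k
  obtain N M where
    NM: "\<And>n. n \<ge> N \<Longrightarrow> ratfun_pdvd k (X n - X' n)" "\<And>n. n \<ge> M \<Longrightarrow> ratfun_pdvd k (Y n - Y' n)"
    using assms unfolding ratfun_rel_def by metis
  have "X n * Y n - X' n * Y' n = (X n - X' n) * Y n + X' n * (Y n - Y' n)" for n
    by (simp add: algebra_simps)
  then show "\<exists>N. \<forall>n\<ge>N. ratfun_pdvd k (X n * Y n - X' n * Y' n)"
    using NM R
    by (intro exI[of _ "max N M"]) (simp add: ratfun_pdvd_add ratfun_pdvd_mult ratfun_pdvd_mult')
qed

lemma not_ratfun_pdvd_1: "\<not> ratfun_pdvd (Suc 0) (1 :: 'p::prime_card ratfun)"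
proof
  assume "ratfun_pdvd (Suc 0) (1 :: 'p ratfun)"
  then obtain r :: "'p ratfun" where r: "r \<in> ratfun_ring" "1 = of_nat CARD('p) * r"
    by (auto simp: ratfun_pdvd_def)
  from r(1) obtain f g where fg: "r = Fract f g" "\<not> of_nat CARD('p) dvd g" "g \<noteq> 0"
    by (rule ratfun_ring_cases)
  have "Fract 1 1 = Fract (of_nat CARD('p) * f) g"
    using r(2) fg(1) by (simp add: fract_collapse Fract_of_nat_eq[symmetric])
  then have "g = of_nat CARD('p) * f" using fg(3) by (simp add: eq_fract)
  with fg(2) show False by simp
qed

text \<open>The p-adic completion, as Cauchy sequences modulo null sequences.\<close>

quotient_type (overloaded) 'p ratfun_completion =
  "nat \<Rightarrow> 'p::prime_card ratfun" / partial: ratfun_rel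
proof (rule part_equivpI)
  show "\<exists>x. ratfun_rel x x"
    by (auto simp: ratfun_rel_refl intro: ratfun_Cauchy_const ratfun_ring_0)
  show "symp ratfun_rel" by (rule sympI) (rule ratfun_rel_sym)
  show "transp ratfun_rel" by (rule transpI) (rule ratfun_rel_trans)
qed

instantiation ratfun_completion :: (prime_card) comm_ring_1
begin

lift_definition zero_ratfun_completion :: "'a ratfun_completion" is "\<lambda>_. 0"
  by (simp add: ratfun_rel_refl ratfun_Cauchy_const ratfun_ring_0)

lift_definition one_ratfun_completion :: "'a ratfun_completion" is "\<lambda>_. 1"
  by (simp add: ratfun_rel_refl ratfun_Cauchy_const ratfun_ring_1)

lift_definition plus_ratfun_completion ::
    "'a ratfun_completion \<Rightarrow> 'a ratfun_completion \<Rightarrow> 'a ratfun_completion"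
  is "\<lambda>X Y n. X n + Y n"
  by (rule ratfun_rel_add)

lift_definition uminus_ratfun_completion :: "'a ratfun_completion \<Rightarrow> 'a ratfun_completion"
  is "\<lambda>X n. - X n"
  by (rule ratfun_rel_uminus)

definition minus_ratfun_completion ::
    "'a ratfun_completion \<Rightarrow> 'a ratfun_completion \<Rightarrow> 'a ratfun_completion" where
  "minus_ratfun_completion x y = x + - y"

lift_definition times_ratfun_completion ::
    "'a ratfun_completion \<Rightarrow> 'a ratfun_completion \<Rightarrow> 'a ratfun_completion"
  is "\<lambda>X Y n. X n * Y n"
  by (rule ratfun_rel_mult)

instance
proof
  fix a b c :: "'a ratfun_completion"
  note C = ratfun_rel_refl ratfun_Cauchy_add ratfun_Cauchy_mult ratfun_Cauchy_const
    ratfun_ring_0 ratfun_ring_1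
  show "a * b * c = a * (b * c)"
    by transfer (simp add: C mult.assoc)
  show "a * b = b * a"
    by transfer (simp add: C mult.commute)
  show "1 * a = a"
    by transfer (simp add: C)
  show "(a + b) * c = a * c + b * c"
    by transfer (simp add: C distrib_right)
  show "a + b + c = a + (b + c)"
    by transfer (simp add: C add.assoc)
  show "a + b = b + a"
    by transfer (simp add: C add.commute)
  show "0 + a = a"
    by transfer (simp add: C)
  show "- a + a = 0"
    by transfer (simp add: C)
  show "a - b = a + - b"
    by (simp add: minus_ratfun_completion_def)
  show "(0::'a ratfun_completion) \<noteq> 1"
  proof
    assume "(0::'a ratfun_completion) = 1"
    then have "(1::'a ratfun_completion) = 0" ..
    then have "ratfun_rel (\<lambda>_. 1 :: 'a ratfun) (\<lambda>_. 0)" by transfer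
    then show False using not_ratfun_pdvd_1[where 'p='a]
      by (auto simp: ratfun_rel_def)
  qed
qed

end

text \<open>The canonical map into the completion; it is only meaningful on ratfun_ring.\<close>

lift_definition of_ratfun :: "'p::prime_card ratfun \<Rightarrow> 'p ratfun_completion"
  is "\<lambda>x _. if x \<in> ratfun_ring then x else 0"
  by (simp add: ratfun_rel_refl ratfun_Cauchy_const ratfun_ring_0)

definition completion_t :: "'p::prime_card ratfun_completion" where
  "completion_t = of_ratfun (Fract [:0, 1:] 1)"

definition padic_converges ::
    "(nat \<Rightarrow> 'p::prime_card ratfun_completion) \<Rightarrow> 'p ratfun_completion \<Rightarrow> bool" where
  "padic_converges X L \<longleftrightarrow> (\<forall>k. \<exists>N. \<forall>n\<ge>N. of_nat CARD('p) ^ k dvd X n - L)"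

definition padic_lim ::
    "(nat \<Rightarrow> 'p::prime_card ratfun_completion) \<Rightarrow> 'p ratfun_completion" where
  "padic_lim X = (THE L. padic_converges X L)"

text \<open>
  A power series phi and an element x of the completion are identified if, for every n, both
  are congruent modulo p^n to the same fraction f/g with g(0) a unit.  (Such a g is invertible as
  a power series, so the last conjunct says that phi is congruent to the expansion of f/g.)
\<close>

definition has_expansion ::
    "'p::prime_card ratfun_completion \<Rightarrow> 'p padic_int fps \<Rightarrow> bool" where
  "has_expansion x \<phi> \<longleftrightarrow> (\<forall>n. \<exists>f g. poly g 0 dvd 1 \<and>
     of_nat CARD('p) ^ n dvd x - of_ratfun (Fract f g) \<and>
     of_nat CARD('p) ^ n dvd \<phi> * fps_of_poly g - fps_of_poly f)"

lemma of_ratfun_add: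
  "x \<in> ratfun_ring \<Longrightarrow> y \<in> ratfun_ring \<Longrightarrow> of_ratfun (x + y) = of_ratfun x + of_ratfun y"
  by transfer (simp add: ratfun_rel_refl ratfun_Cauchy_const ratfun_ring_add)

lemma of_ratfun_mult:
  "x \<in> ratfun_ring \<Longrightarrow> y \<in> ratfun_ring \<Longrightarrow> of_ratfun (x * y) = of_ratfun x * of_ratfun y"
  by transfer (simp add: ratfun_rel_refl ratfun_Cauchy_const ratfun_ring_mult)

lemma of_ratfun_1: "of_ratfun 1 = 1"
  by transfer (simp add: ratfun_rel_refl ratfun_Cauchy_const ratfun_ring_1)

lemma of_ratfun_uminus: "x \<in> ratfun_ring \<Longrightarrow> of_ratfun (- x) = - of_ratfun x"
  by transfer (simp add: ratfun_rel_refl ratfun_Cauchy_const ratfun_ring_uminus)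

lemma of_ratfun_diff:
  "x \<in> ratfun_ring \<Longrightarrow> y \<in> ratfun_ring \<Longrightarrow> of_ratfun (x - y) = of_ratfun x - of_ratfun y"
  using of_ratfun_add[of x "- y"] by (simp add: of_ratfun_uminus ratfun_ring_uminus)

lemma ratfun_ring_of_nat: "of_nat n \<in> ratfun_ring"
  by (induction n) (simp_all add: ratfun_ring_0 ratfun_ring_1 ratfun_ring_add)

lemma ratfun_ring_power: "x \<in> ratfun_ring \<Longrightarrow> x ^ n \<in> ratfun_ring"
  by (induction n) (simp_all add: ratfun_ring_1 ratfun_ring_mult)

lemma of_ratfun_of_nat: "of_ratfun (of_nat n) = of_nat n"
proof (induction n)
  case 0
  have "of_ratfun 0 = (0 :: 'a ratfun_completion)"
    by transfer (simp add: ratfun_rel_refl ratfun_Cauchy_const ratfun_ring_0)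
  then show ?case by simp
qed (simp add: of_ratfun_add of_ratfun_1 ratfun_ring_1 ratfun_ring_of_nat)

lemma of_ratfun_power: "x \<in> ratfun_ring \<Longrightarrow> of_ratfun (x ^ n) = of_ratfun x ^ n"
  by (induction n) (simp_all add: of_ratfun_1 of_ratfun_mult ratfun_ring_power)

lemma completion_separated:
  assumes "\<And>k. of_nat CARD('p) ^ k dvd (x :: 'p::prime_card ratfun_completion)"
  shows "x = 0"
proof -
  let ?p = "of_nat CARD('p) :: 'p ratfun"
  have ex: "\<forall>k. \<exists>y. x = of_ratfun (?p ^ k) * y"
    using assms by (auto simp: of_ratfun_power ratfun_ring_of_nat of_ratfun_of_nat dvd_def)
  have pR: "?p ^ k \<in> ratfun_ring" for k
    by (simp add: ratfun_ring_power ratfun_ring_of_nat)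
  from ex show ?thesis
  proof (transfer, goal_cases)
    case (1 X)
    show ?case
      unfolding ratfun_rel_def
    proof (intro conjI allI)
      show "ratfun_Cauchy X" using 1(1) by (simp add: ratfun_rel_def)
      show "ratfun_Cauchy (\<lambda>_. 0 :: 'p ratfun)" by (intro ratfun_Cauchy_const ratfun_ring_0)
      fix k
      obtain Y where Y: "ratfun_rel Y Y" "ratfun_rel X (\<lambda>n. ?p ^ k * Y n)"
        using 1(2)[rule_format, of k] pR[of k] by (auto simp: Bex_def Respects_def)
      obtain N where N: "\<And>n. n \<ge> N \<Longrightarrow> ratfun_pdvd k (X n - ?p ^ k * Y n)"
        using Y(2) unfolding ratfun_rel_def by metis
      have "Y n \<in> ratfun_ring" for n
        using Y(1) by (simp add: ratfun_rel_def ratfun_Cauchy_def)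
      then have "ratfun_pdvd k (?p ^ k * Y n)" for n
        unfolding ratfun_pdvd_def by blast
      then have "ratfun_pdvd k (X n)" if "n \<ge> N" for n
        using ratfun_pdvd_add[OF N[OF that], of "?p ^ k * Y n"] by simp
      then show "\<exists>N. \<forall>n\<ge>N. ratfun_pdvd k (X n - 0)" by auto
    qed
  qed
qed

lemma padic_converges_unique:
  assumes "padic_converges X L" "padic_converges X L'"
  shows "L = L'"
proof -
  have "of_nat CARD('a) ^ k dvd L - L'" for k
  proof -
    obtain N M where
      "\<And>n. n \<ge> N \<Longrightarrow> of_nat CARD('a) ^ k dvd X n - L"
      "\<And>n. n \<ge> M \<Longrightarrow> of_nat CARD('a) ^ k dvd X n - L'"
      using assms unfolding padic_converges_def by metis
    then have "of_nat CARD('a) ^ k dvd (X (max N M) - L') - (X (max N M) - L)"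
      by (rule_tac dvd_diff) auto
    then show ?thesis by simp
  qed
  then show ?thesis using completion_separated[of "L - L'"] by simp
qed

lemma padic_lim_eq: "padic_converges X L \<Longrightarrow> padic_lim X = L"
  unfolding padic_lim_def by (blast intro: padic_converges_unique)

lemma has_expansion_unique:
  assumes "has_expansion x \<phi>" "has_expansion y \<phi>"
  shows "x = (y :: 'p::prime_card ratfun_completion)"
proof -
  have "of_nat CARD('p) ^ n dvd x - y" for n
  proof -
    let ?P = "of_nat CARD('p) ^ n :: 'p padic_int"
    obtain f g f' g' where
      u: "poly g 0 dvd 1" "poly g' 0 dvd 1" and
      x: "of_nat CARD('p) ^ n dvd x - of_ratfun (Fract f g)" and
      y: "of_nat CARD('p) ^ n dvd y - of_ratfun (Fract f' g')" and
      \<phi>: "of_nat CARD('p) ^ n dvd \<phi> * fps_of_poly g - fps_of_poly f"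
         "of_nat CARD('p) ^ n dvd \<phi> * fps_of_poly g' - fps_of_poly f'"
      using assms unfolding has_expansion_def by meson
    have nd: "\<not> of_nat CARD('p) dvd h" if "poly h 0 dvd 1" for h :: "'p padic_int poly"
    proof
      assume "of_nat CARD('p) dvd h"
      then have "of_nat CARD('p) dvd poly h 0" by (auto simp: dvd_def)
      then have "of_nat CARD('p) dvd (1 :: 'p padic_int)" using that dvd_trans by blast
      then show False using prime_elem_not_unit[OF prime_elem_padic[where 'p='p]] by simp
    qed
    have gg: "\<not> of_nat CARD('p) dvd g" "\<not> of_nat CARD('p) dvd g'"
      using u nd by auto
    then have gg': "\<not> of_nat CARD('p) dvd g * g'"
      using prime_elem_dvd_mult_iff[OF prime_elem_padic_poly] by blast
    have nz: "g \<noteq> 0" "g' \<noteq> 0" using gg by auto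
    have "of_nat CARD('p) ^ n dvd
        (\<phi> * fps_of_poly g' - fps_of_poly f') * fps_of_poly g
        - (\<phi> * fps_of_poly g - fps_of_poly f) * fps_of_poly g'"
      by (rule dvd_diff[OF dvd_mult2[OF \<phi>(2)] dvd_mult2[OF \<phi>(1)]])
    also have "\<dots> = fps_of_poly (f * g' - f' * g)"
      by (simp add: fps_of_poly_diff fps_of_poly_mult algebra_simps)
    finally obtain H where H: "fps_of_poly (f * g' - f' * g) = of_nat CARD('p) ^ n * H"
      by (elim dvdE)
    have "of_nat CARD('p) ^ n * H = fps_const ?P * H"
      by (metis fps_const_power fps_of_nat)
    then have "?P dvd Polynomial.coeff (f * g' - f' * g) i" for i
      using H by (metis dvd_triv_left fps_mult_left_const_nth fps_of_poly_nth)
    then have "[:?P:] dvd f * g' - f' * g" by (subst const_poly_dvd_iff) blast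
    then obtain h where "f * g' - f' * g = [:?P:] * h" by (elim dvdE)
    moreover have "[:?P:] = of_nat CARD('p) ^ n" by (simp add: of_nat_poly poly_const_pow)
    ultimately have h: "f * g' - f' * g = of_nat CARD('p) ^ n * h" by simp
    have "of_ratfun (Fract f g) - of_ratfun (Fract f' g') = of_ratfun (Fract f g - Fract f' g')"
      using gg by (simp add: of_ratfun_diff ratfun_ringI)
    also have "Fract f g - Fract f' g' = Fract (of_nat CARD('p) ^ n * h) (g * g')"
      using nz h by simp
    also have "\<dots> = Fract (of_nat (CARD('p) ^ n)) 1 * Fract h (g * g')" by simp
    also have "\<dots> = of_nat CARD('p) ^ n * Fract h (g * g')"
      by (subst Fract_of_nat_eq) simp
    also have "of_ratfun \<dots> = of_nat CARD('p) ^ n * of_ratfun (Fract h (g * g'))"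
      using gg' by (simp add: of_ratfun_mult of_ratfun_power of_ratfun_of_nat
        ratfun_ring_power ratfun_ring_of_nat ratfun_ringI)
    finally have d: "of_nat CARD('p) ^ n dvd of_ratfun (Fract f g) - of_ratfun (Fract f' g')"
      by simp
    show ?thesis using dvd_diff[OF dvd_add[OF x d] y] by simp
  qed
  then show ?thesis using completion_separated[of "x - y"] by simp
qed

section \<open>Inverting the variable\<close>

text \<open>The value f(1/t) in the field of fractions, and the substitution of 1/t for t.\<close>

definition poly_at_inverse :: "'a::idom poly \<Rightarrow> 'a poly fract" where
  "poly_at_inverse f = poly (map_poly (\<lambda>c. to_fract [:c:]) f) (inverse (to_fract [:0, 1:]))"

definition ratfun_invert :: "'a::idom poly fract \<Rightarrow> 'a poly fract" where
  "ratfun_invert x =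
     (THE y. \<forall>f g. g \<noteq> 0 \<longrightarrow> x = Fract f g \<longrightarrow> y = poly_at_inverse f / poly_at_inverse g)"

lemma poly_at_inverse_mult: "poly_at_inverse (f * g) = poly_at_inverse f * poly_at_inverse g"
proof -
  interpret map_poly_comm_ring_hom "\<lambda>c :: 'a. to_fract [:c:]"
    by unfold_locales (simp_all add: one_pCons[symmetric] flip: to_fract_add to_fract_mult)
  show ?thesis by (simp add: poly_at_inverse_def hom_mult)
qed

lemma poly_map_poly_to_fract_const:
  "poly (map_poly (\<lambda>c. to_fract [:c:]) f) (to_fract [:0, 1:]) = to_fract (f :: 'a::idom poly)"
proof (induction f)
  case (pCons a f)
  have "pCons a f = [:a:] + [:0, 1:] * f" by simp
  then have "to_fract (pCons a f) = to_fract [:a:] + to_fract [:0, 1:] * to_fract f"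
    by (metis to_fract_add to_fract_mult)
  with pCons show ?case by (simp add: map_poly_pCons)
qed simp

lemma poly_at_inverse_reflect:
  "poly_at_inverse f * to_fract [:0, 1:] ^ degree f = to_fract (reflect_poly (f :: 'a::idom poly))"
proof -
  let ?C = "\<lambda>c :: 'a. to_fract [:c:]"
  have d: "degree (map_poly ?C f) = degree f" by (rule degree_map_poly) simp
  have "map_poly ?C (reflect_poly f) = reflect_poly (map_poly ?C f)"
    by (rule poly_eqI) (simp add: coeff_map_poly coeff_reflect_poly d)
  then show ?thesis
    using poly_reflect_poly_nz[of "to_fract [:0, 1:]" "map_poly ?C f"]
      poly_map_poly_to_fract_const[of "reflect_poly f"]
    by (simp add: poly_at_inverse_def d mult.commute)
qed

lemma poly_at_inverse_eq_0_iff: "poly_at_inverse f = 0 \<longleftrightarrow> f = 0"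
proof
  assume "poly_at_inverse f = 0"
  then have "to_fract (reflect_poly f) = 0" using poly_at_inverse_reflect[of f] by simp
  then show "f = 0" by simp
qed (simp add: poly_at_inverse_def)

lemma ratfun_invert_Fract:
  assumes "g \<noteq> 0"
  shows "ratfun_invert (Fract f g) = poly_at_inverse f / poly_at_inverse g"
  unfolding ratfun_invert_def
proof (rule the_equality)
  show "\<forall>f' g'. g' \<noteq> 0 \<longrightarrow> Fract f g = Fract f' g' \<longrightarrow>
      poly_at_inverse f / poly_at_inverse g = poly_at_inverse f' / poly_at_inverse g'"
  proof (intro allI impI)
    fix f' g' assume g': "g' \<noteq> 0" and eq: "Fract f g = Fract f' g'"
    then have "f * g' = f' * g" using assms by (simp add: eq_fract)
    then have "poly_at_inverse f * poly_at_inverse g' = poly_at_inverse f' * poly_at_inverse g"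
      by (metis poly_at_inverse_mult)
    then show "poly_at_inverse f / poly_at_inverse g = poly_at_inverse f' / poly_at_inverse g'"
      using assms g' by (simp add: frac_eq_eq poly_at_inverse_eq_0_iff)
  qed
qed (use assms in blast)

lemma ratfun_invert_ring:
  assumes "x \<in> ratfun_ring"
  shows "ratfun_invert x \<in> (ratfun_ring :: 'p::prime_card ratfun set)"
proof -
  from assms obtain f g :: "'p padic_int poly"
    where x: "x = Fract f g" and g: "\<not> of_nat CARD('p) dvd g" "g \<noteq> 0"
    by (rule ratfun_ring_cases)
  let ?p = "of_nat CARD('p) :: 'p padic_int poly" and ?t = "[:0, 1:] :: 'p padic_int poly"
  have to_fract_t: "to_fract ?t ^ i = to_fract (?t ^ i)" for i
    by (induction i) (simp_all only: power_Suc power_0 to_fract_1 to_fract_mult)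
  have inv: "poly_at_inverse h = Fract (reflect_poly h) (?t ^ degree h)" for h :: "'p padic_int poly"
  proof -
    have "poly_at_inverse h = to_fract (reflect_poly h) / to_fract (?t ^ degree h)"
      using poly_at_inverse_reflect[of h]
      by (simp add: to_fract_t[symmetric] nonzero_eq_divide_eq)
    then show ?thesis by (simp add: to_fract_def)
  qed
  have p: "?p = [:of_nat CARD('p):]" by (simp add: of_nat_poly)
  have "\<not> ?p dvd ?t"
  proof
    assume "?p dvd ?t"
    then have "of_nat CARD('p) dvd Polynomial.coeff ?t 1"
      unfolding p const_poly_dvd_iff by blast
    then show False using prime_elem_not_unit[OF prime_elem_padic[where 'p='p]] by simp
  qed
  then have t: "\<not> ?p dvd ?t ^ i" for i
    using prime_elem_dvd_power[OF prime_elem_padic_poly[where 'p='p]] by blast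
  have "\<not> ?p dvd reflect_poly g"
  proof
    assume r: "?p dvd reflect_poly g"
    have "of_nat CARD('p) dvd Polynomial.coeff g i" for i
    proof (cases "i \<le> degree g")
      case True
      have "of_nat CARD('p) dvd Polynomial.coeff (reflect_poly g) (degree g - i)"
        using r unfolding p const_poly_dvd_iff by blast
      moreover have "\<not> degree g < degree g - i" "degree g - (degree g - i) = i"
        using True by linarith+
      ultimately show ?thesis by (simp only: coeff_reflect_poly if_False)
    qed (simp add: coeff_eq_0)
    then have "?p dvd g" unfolding p const_poly_dvd_iff by blast
    with g show False by simp
  qed
  then have "\<not> ?p dvd ?t ^ degree f * reflect_poly g"
    using t prime_elem_dvd_mult_iff[OF prime_elem_padic_poly[where 'p='p]] by blast
  then have "Fract (reflect_poly f * ?t ^ degree g) (?t ^ degree f * reflect_poly g) \<in> ratfun_ring"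
    by (rule ratfun_ringI)
  then show ?thesis using g by (simp add: x ratfun_invert_Fract inv)
qed

section \<open>Dwork's p-adic hypergeometric function for s = 1\<close>

lemma pochhammer_cong_mod:
  "(x::int) mod q = y mod q \<Longrightarrow> pochhammer x k mod q = pochhammer y k mod q"
  by (induction k) (auto simp: pochhammer_Suc intro!: mod_mult_cong mod_add_cong)

lemma padic_pochhammer:
  "Rep_padic_int (pochhammer (b :: 'p::prime_card padic_int) k) n =
     pochhammer (Rep_padic_int b n) k mod int CARD('p) ^ n"
  by (induction k)
    (simp_all add: pochhammer_Suc one_padic_int.rep_eq times_padic_int.rep_eq
      plus_padic_int.rep_eq padic_of_nat mod_simps)

lemma padic_fact_dvd_pochhammer:
  "fact k dvd pochhammer (b :: 'p::prime_card padic_int) k"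
proof -
  let ?p = "int CARD('p)" and ?F = "fact k :: int"
  define N where "N = multiplicity ?p ?F"
  have p: "prime ?p" by (rule prime_card_int)
  then have "\<not> is_unit ?p" by auto
  then obtain m where m: "?F = ?p ^ N * m" "\<not> ?p dvd m"
    using multiplicity_decompose'[of ?F ?p] unfolding N_def by auto
  define q where "q = (\<lambda>n. pochhammer (Rep_padic_int b n) k)"
  define d where "d = (\<lambda>n. q (n + N) div ?F)"
  have Fd: "?F * d n = q (n + N)" for n
    unfolding d_def q_def by (rule dvd_mult_div_cancel[OF fact_dvd_pochhammer])
  have q_mod: "q n' mod ?p ^ n = q n mod ?p ^ n" if "n \<le> n'" for n n'
    unfolding q_def by (rule pochhammer_cong_mod) (simp add: padic_mod_le that padic_mod)
  have coh: "d n mod ?p ^ n = d (Suc n) mod ?p ^ Suc n mod ?p ^ n" for n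
  proof -
    have "?p ^ (n + N) dvd q (Suc n + N) - q (n + N)"
      using q_mod[of "n + N" "Suc n + N"] by (simp add: mod_eq_dvd_iff)
    also have "q (Suc n + N) - q (n + N) = ?p ^ N * (m * (d (Suc n) - d n))"
      by (simp only: Fd[symmetric] m(1) right_diff_distrib mult.assoc)
    finally have "?p ^ N * ?p ^ n dvd ?p ^ N * (m * (d (Suc n) - d n))"
      by (simp only: power_add mult.commute)
    then have "?p ^ n dvd m * (d (Suc n) - d n)"
      using prime_gt_0_int[OF p] by (simp only: dvd_mult_cancel_left) auto
    moreover have "coprime (?p ^ n) m"
      using prime_imp_coprime[OF p m(2)] by simp
    ultimately have "?p ^ n dvd d (Suc n) - d n"
      by (simp add: coprime_dvd_mult_right_iff)
    then show ?thesis by (simp only: mod_power_Suc) (simp add: mod_eq_dvd_iff dvd_diff_commute)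
  qed
  define z :: "'p padic_int" where "z = Abs_padic_int (\<lambda>n. d n mod ?p ^ n)"
  have rz: "Rep_padic_int z = (\<lambda>n. d n mod ?p ^ n)"
    unfolding z_def by (rule Abs_padic_int_inverse, unfold mem_Collect_eq, rule allI, rule coh)
  have "Rep_padic_int (of_nat (fact k) * z) n = Rep_padic_int (pochhammer b k) n" for n
  proof -
    have "Rep_padic_int (fact k :: 'p padic_int) n = ?F mod ?p ^ n"
      using padic_of_nat[where 'p='p, of "fact k" n] by simp
    then have "Rep_padic_int (of_nat (fact k) * z) n = ?F * d n mod ?p ^ n"
      by (simp add: times_padic_int.rep_eq padic_of_nat rz mod_simps)
    also have "\<dots> = q n mod ?p ^ n" unfolding Fd by (rule q_mod) simp
    finally show ?thesis by (simp add: padic_pochhammer q_def)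
  qed
  then have "of_nat (fact k) * z = pochhammer b k" by (rule padic_eqI)
  then show ?thesis by (metis dvd_triv_left of_nat_fact)
qed

lemma dwork_digit_ex1:
  "\<exists>!l. l < CARD('p) \<and> of_nat CARD('p) dvd (b :: 'p::prime_card padic_int) + of_nat l"
proof -
  let ?b = "Rep_padic_int b 1" and ?p = "int CARD('p)"
  have p: "0 < ?p" using prime_gt_0_nat[OF prime_card[where 'a='p]] by simp
  have iff: "of_nat CARD('p) dvd b + of_nat l \<longleftrightarrow> ?p dvd ?b + int l" for l
    by (simp add: padic_dvd_iff plus_padic_int.rep_eq padic_of_nat mod_simps dvd_eq_mod_eq_0)
  show ?thesis
  proof (rule ex1I[of _ "nat ((- ?b) mod ?p)"])
    define l where "l = nat ((- ?b) mod ?p)"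
    have l: "int l = (- ?b) mod ?p" using p by (simp add: l_def)
    have "?p dvd ?b + int l"
      unfolding l by (simp add: dvd_eq_mod_eq_0 mod_simps)
    moreover have "l < CARD('p)" using p l pos_mod_bound[of ?p "- ?b"] by linarith
    ultimately show "nat ((- ?b) mod ?p) < CARD('p) \<and>
        of_nat CARD('p) dvd b + of_nat (nat ((- ?b) mod ?p))"
      unfolding iff l_def by blast
  next
    fix l assume l: "l < CARD('p) \<and> of_nat CARD('p) dvd b + of_nat l"
    then have "?p dvd int l - (- ?b)" by (simp add: iff add.commute)
    then have "int l mod ?p = (- ?b) mod ?p" by (simp add: mod_eq_dvd_iff)
    with l show "l = nat ((- ?b) mod ?p)" by simp
  qed
qed

definition dwork_digit :: "'p::prime_card padic_int \<Rightarrow> nat" where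
  "dwork_digit b = (THE l. l < CARD('p) \<and> of_nat CARD('p) dvd b + of_nat l)"

definition dwork_prime :: "'p::prime_card padic_int \<Rightarrow> 'p padic_int" where
  "dwork_prime b = (b + of_nat (dwork_digit b)) div of_nat CARD('p)"

definition hyp_series :: "'p::prime_card padic_int \<Rightarrow> 'p padic_int fps" where
  "hyp_series b = Abs_fps (\<lambda>k. pochhammer b k div fact k)"

text \<open>The series F(t^p) attached to the Dwork prime of b.\<close>

definition dwork_denom :: "'p::prime_card padic_int \<Rightarrow> 'p padic_int fps" where
  "dwork_denom b = fps_compose (hyp_series (dwork_prime b)) (fps_X ^ CARD('p))"

text \<open>
  The quotient of power series F_b(t) / F_b'(t^p); the denominator has constant term 1
  (see dwork_denom_0 and dwork_series_eq below).
\<close>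

definition dwork_series :: "'p::prime_card padic_int \<Rightarrow> 'p padic_int fps" where
  "dwork_series b = hyp_series b * fps_right_inverse (dwork_denom b) 1"

definition fps_trunc :: "nat \<Rightarrow> 'a::comm_monoid_add fps \<Rightarrow> 'a poly" where
  "fps_trunc m f = (\<Sum>i<m. Polynomial.monom (fps_nth f i) i)"

text \<open>
  The rational functions of Dwork's congruence.  Truncation of F_b'(t^p) is in the variable t.
\<close>

definition dwork_approx :: "'p::prime_card padic_int \<Rightarrow> nat \<Rightarrow> 'p ratfun" where
  "dwork_approx b n =
     Fract (fps_trunc (CARD('p) ^ n) (hyp_series b)) (fps_trunc (CARD('p) ^ n) (dwork_denom b))"

lemma dwork_denom_0: "fps_nth (dwork_denom b) 0 = 1"
  by (simp add: dwork_denom_def hyp_series_def)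

lemma dwork_series_eq: "dwork_series b * dwork_denom b = hyp_series b"
proof -
  have "dwork_denom b * fps_right_inverse (dwork_denom b) 1 = 1"
    by (rule fps_right_inverse) (simp add: dwork_denom_0)
  then show ?thesis by (simp add: dwork_series_def mult.assoc mult.commute)
qed

lemma dwork_approx_ring: "dwork_approx b n \<in> ratfun_ring"
proof -
  have "poly (fps_trunc (CARD('a) ^ n) (dwork_denom b)) 0 = 1"
  proof -
    have c: "Polynomial.coeff (fps_trunc m f) 0 = (if m = 0 then 0 else fps_nth f 0)"
      for m and f :: "'a padic_int fps"
      by (simp add: fps_trunc_def coeff_sum if_distrib sum.delta)
    show ?thesis
      using prime_gt_0_nat[OF prime_card[where 'a='a]]
      by (simp add: poly_0_coeff_0 c dwork_denom_0)
  qed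
  moreover have "poly (of_nat CARD('a) * h) 0 \<noteq> (1 :: 'a padic_int)" for h
    using prime_elem_not_unit[OF prime_elem_padic[where 'p='a]] by (auto simp: dvd_def)
  ultimately have "\<not> of_nat CARD('a) dvd fps_trunc (CARD('a) ^ n) (dwork_denom b)"
    by (metis dvdE)
  then show ?thesis unfolding dwork_approx_def by (rule ratfun_ringI)
qed

text \<open>
  The function F^Dw_b(t) as an element of the completion: the unique element (has_expansion_unique)
  identified with the power series.  Its existence is Dwork's congruence.
\<close>

definition dwork :: "'p::prime_card padic_int \<Rightarrow> 'p ratfun_completion" where
  "dwork b = (THE x. has_expansion x (dwork_series b))"

text \<open>
  F^Dw_b(1/t): substitute 1/t in the rational functions of Dwork's congruence and pass to the
  p-adic limit (which is unique by padic_lim_eq).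
\<close>

definition dwork_inv :: "'p::prime_card padic_int \<Rightarrow> 'p ratfun_completion" where
  "dwork_inv b = padic_lim (\<lambda>n. of_ratfun (ratfun_invert (dwork_approx b n)))"

end

theory Submission
  imports Defs
begin

text \<open>
  Write F_b(t) = (1 - t)^(-b), b + l = p b', and N = p^n.  The truncation P of F_b below degree N
  satisfies (1 - t) P' = b P - N h_N t^(N - 1) with h_N the N-th coefficient of F_b, so the
  coefficients of P F_(-b) have the closed form
  (-1)^(k - N + 1) C(k - 1, N - 1) h(b - (k - N), k) for k at least N, where h(c, k) is the k-th
  coefficient of F_c.  Removing the multiples of p from
  the products defining h relates h(b, p k) to h(b', k), and yields that P F_(-b) is congruent
  modulo p^n to the same expression for b', truncated below p^(n - 1), at t^p.  This is Dwork's
  congruence.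

  If m is a natural number congruent to -b' modulo p^n, then the Dwork function is also congruent
  modulo p^n to (1 - t)^(l + p m) / (1 - t^p)^m, on which the substitution of 1/t for t produces
  the factor (-1)^((p + 1) m) (-t)^(-l); the sign matters only for p = 2, where it is (-1)^b'.
\<close>

section \<open>The binomial series and its truncations\<close>

abbreviation hyp_coeff :: "'p::prime_card padic_int \<Rightarrow> nat \<Rightarrow> 'p padic_int" where
  "hyp_coeff b k \<equiv> fps_nth (hyp_series b) k"

lemma fact_mult_hyp_coeff: "fact k * hyp_coeff b k = pochhammer b k"
  by (simp add: hyp_series_def padic_fact_dvd_pochhammer)

text \<open>Factorials are nonzero in this domain of characteristic zero, so identities between
  coefficients can be proved after multiplication by \<open>fact k\<close>, where no quotient is
  left.\<close>

lemma hyp_coeff_unique: "fact k * x = pochhammer b k \<Longrightarrow> x = hyp_coeff b k"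
  by (metis fact_mult_hyp_coeff fact_nonzero mult_left_cancel)

lemma hyp_coeff_0 [simp]: "hyp_coeff b 0 = 1"
  by (simp add: hyp_series_def)

text \<open>After multiplication by \<open>fact n\<close> this is the Vandermonde convolution of
  rising factorials. It makes \<open>hyp_series (- b)\<close> the inverse of
  \<open>hyp_series b\<close>.\<close>

lemma hyp_series_mult: "hyp_series a * hyp_series b = hyp_series (a + b)"
proof (rule fps_ext, rule hyp_coeff_unique)
  fix n
  have "fact n * (hyp_coeff a k * hyp_coeff b (n - k)) =
      of_nat (n choose k) * pochhammer a k * pochhammer b (n - k)" if "k \<le> n" for k
  proof -
    have "(fact n :: 'a padic_int) = of_nat (fact k * fact (n - k) * (n choose k))"
      using binomial_fact_lemma[OF that] by (metis of_nat_fact)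
    then show ?thesis
      by (simp add: fact_mult_hyp_coeff[symmetric] mult_ac)
  qed
  then show "fact n * fps_nth (hyp_series a * hyp_series b) n = pochhammer (a + b) n"
    by (simp add: fps_mult_nth sum_distrib_left pochhammer_binomial_sum atLeast0AtMost)
qed

lemma hyp_series_0 [simp]: "hyp_series 0 = 1"
  by (rule fps_ext) (simp add: hyp_series_def pochhammer_0_left)

lemma hyp_series_minus_1: "hyp_series (- 1) = 1 - fps_X"
proof (rule fps_ext, rule hyp_coeff_unique[symmetric])
  fix n
  show "fact n * fps_nth (1 - fps_X) n = pochhammer (- 1 :: 'a padic_int) n"
  proof (cases "n \<le> 1")
    case True
    then have "n = 0 \<or> n = 1" by linarith
    then show ?thesis by auto
  next
    case False
    then obtain m where "n = Suc (Suc m)" by (metis One_nat_def not0_implies_Suc not_less_eq_eq zero_le)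
    then show ?thesis by (simp add: pochhammer_rec fps_X_def)
  qed
qed

lemma hyp_series_minus_of_nat:
  "hyp_series (- of_nat m :: 'p::prime_card padic_int) = (1 - fps_X) ^ m"
proof (induction m)
  case (Suc m)
  have "hyp_series (- of_nat (Suc m) :: 'p padic_int) = hyp_series (- 1) * hyp_series (- of_nat m)"
    by (simp add: hyp_series_mult)
  then show ?case by (simp only: Suc.IH hyp_series_minus_1 power_Suc)
qed simp

lemma Suc_mult_hyp_coeff: "of_nat (Suc k) * hyp_coeff b (Suc k) = (b + of_nat k) * hyp_coeff b k"
proof -
  have "fact k * (of_nat (Suc k) * hyp_coeff b (Suc k)) = fact k * ((b + of_nat k) * hyp_coeff b k)"
    using fact_mult_hyp_coeff[of "Suc k" b] fact_mult_hyp_coeff[of k b]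
    by (simp add: pochhammer_rec' algebra_simps)
  then show ?thesis by (metis fact_nonzero mult_left_cancel)
qed

text \<open>Besides the derivative of F_b, this yields that every divisor of \<open>b\<close>
  divides i times the i-th coefficient, for positive i.\<close>

lemma Suc_mult_hyp_coeff_shift: "of_nat (Suc k) * hyp_coeff b (Suc k) = b * hyp_coeff (b + 1) k"
proof -
  have "fact k * (of_nat (Suc k) * hyp_coeff b (Suc k)) = fact k * (b * hyp_coeff (b + 1) k)"
    using fact_mult_hyp_coeff[of "Suc k" b] fact_mult_hyp_coeff[of k "b + 1"]
    by (simp add: pochhammer_rec algebra_simps)
  then show ?thesis by (metis fact_nonzero mult_left_cancel)
qed

lemma fps_deriv_hyp_series: "fps_deriv (hyp_series b) = fps_const b * hyp_series (b + 1)"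
  using Suc_mult_hyp_coeff_shift[of _ b] by (intro fps_ext) simp

section \<open>Truncations of F_b and the coefficients of P F_(-b)\<close>

lemma coeff_fps_trunc: "Polynomial.coeff (fps_trunc m f) i = (if i < m then fps_nth f i else 0)"
proof -
  have "Polynomial.coeff (fps_trunc m f) i = (\<Sum>j<m. if j = i then fps_nth f i else 0)"
    unfolding fps_trunc_def coeff_sum by (intro sum.cong) auto
  then show ?thesis by (simp add: sum.delta)
qed

text \<open>The full series solves (1 - t) y' = b y, a recurrence between consecutive coefficients.
  Cutting at N breaks it only in degree N - 1, where the term with the N-th coefficient is
  missing.\<close>

lemma fps_trunc_hyp_series_ode:
  assumes "0 < N"
  shows "(1 - fps_X) * fps_deriv (fps_of_poly (fps_trunc N (hyp_series b))) =
    fps_const b * fps_of_poly (fps_trunc N (hyp_series b)) -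
    fps_const (of_nat N * hyp_coeff b N) * fps_X ^ (N - 1)"
proof (rule fps_ext)
  fix k
  let ?P = "fps_of_poly (fps_trunc N (hyp_series b))"
  have P: "fps_nth ?P i = (if i < N then hyp_coeff b i else 0)" for i
    by (simp add: coeff_fps_trunc)
  have X: "fps_nth (fps_X * fps_deriv ?P) k = of_nat k * fps_nth ?P k"
    by (cases k) simp_all
  have "fps_nth ((1 - fps_X) * fps_deriv ?P) k =
      of_nat (Suc k) * fps_nth ?P (Suc k) - of_nat k * fps_nth ?P k"
    by (simp only: left_diff_distrib fps_sub_nth X) simp
  also have "\<dots> = b * fps_nth ?P k - (if k = N - 1 then of_nat N * hyp_coeff b N else 0)"
  proof (cases "Suc k = N")
    case True
    then show ?thesis
      using Suc_mult_hyp_coeff[of k b] by (simp only: P) (auto simp: algebra_simps)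
  next
    case False
    with assms have "k \<noteq> N - 1" "Suc k < N \<longleftrightarrow> k < N" by auto
    then show ?thesis
      using Suc_mult_hyp_coeff[of k b] by (simp only: P) (auto simp: algebra_simps)
  qed
  finally show "fps_nth ((1 - fps_X) * fps_deriv ?P) k =
     fps_nth (fps_const b * ?P - fps_const (of_nat N * hyp_coeff b N) * fps_X ^ (N - 1)) k"
    by (simp add: fps_X_power_iff)
qed

text \<open>Writing F_(-b) = (1 - t) F_(1-b) hands the factor 1 - t to the derivative of the
  truncation; the differential equation then cancels the terms with b and leaves the boundary
  term.\<close>

lemma fps_deriv_trunc_quotient:
  assumes "0 < N"
  shows "fps_deriv (fps_of_poly (fps_trunc N (hyp_series b)) * hyp_series (- b)) =
    - fps_const (of_nat N * hyp_coeff b N) * (fps_X ^ (N - 1) * hyp_series (1 - b))"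
proof -
  let ?P = "fps_of_poly (fps_trunc N (hyp_series b))"
  have "hyp_series (- 1 + (1 - b)) = (1 - fps_X) * hyp_series (1 - b)"
    by (simp only: hyp_series_mult[symmetric] hyp_series_minus_1)
  then have F: "hyp_series (- b) = (1 - fps_X) * hyp_series (1 - b)" by simp
  have dF: "fps_deriv (hyp_series (- b)) = - fps_const b * hyp_series (1 - b)"
    by (simp add: fps_deriv_hyp_series)
  have "fps_deriv (?P * hyp_series (- b)) =
      ((1 - fps_X) * fps_deriv ?P) * hyp_series (1 - b) - fps_const b * ?P * hyp_series (1 - b)"
    by (simp only: fps_deriv_mult dF) (simp only: F, simp add: algebra_simps del: fps_const_neg)
  then show ?thesis
    by (simp only: fps_trunc_hyp_series_ode[OF assms], simp add: algebra_simps del: fps_const_neg)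
qed

lemma trunc_quotient_nth_0:
  "0 < N \<Longrightarrow> fps_nth (fps_of_poly (fps_trunc N (hyp_series b)) * hyp_series (- b)) 0 = 1"
  by (simp add: coeff_fps_trunc)

lemma trunc_quotient_nth:
  assumes "0 < N" "0 < k"
  shows "of_nat k * fps_nth (fps_of_poly (fps_trunc N (hyp_series b)) * hyp_series (- b)) k =
    (if k < N then 0 else - (of_nat N * hyp_coeff b N * hyp_coeff (1 - b) (k - N)))"
proof -
  obtain j where k: "k = Suc j" using assms(2) gr0_conv_Suc by blast
  have "of_nat k * fps_nth (fps_of_poly (fps_trunc N (hyp_series b)) * hyp_series (- b)) k =
    fps_nth (fps_deriv (fps_of_poly (fps_trunc N (hyp_series b)) * hyp_series (- b))) j"
    by (simp only: fps_deriv_nth k Suc_eq_plus1)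
  also have "\<dots> = (if k < N then 0 else - (of_nat N * hyp_coeff b N * hyp_coeff (1 - b) (k - N)))"
    unfolding fps_deriv_trunc_quotient[OF assms(1)] 
    using assms by (auto simp: mult.assoc fps_X_power_mult_nth k)
  finally show ?thesis .
qed

section \<open>Products of units over residue classes\<close>

text \<open>Since p is a prime element, its factors pass to \<open>y\<close> one at a time. This
  replaces division by p-adic units throughout.\<close>

lemma padic_power_dvd_cancel:
  fixes x y :: "'p::prime_card padic_int"
  assumes "of_nat CARD('p) ^ n dvd x * y" "\<not> of_nat CARD('p) dvd x"
  shows "of_nat CARD('p) ^ n dvd y"
  using assms(1)
proof (induction n arbitrary: y)
  case (Suc n)
  have "of_nat CARD('p) dvd x * y"
    using Suc.prems by (auto intro: dvd_mult_left)
  then obtain z where z: "y = of_nat CARD('p) * z"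
    using assms(2) prime_elem_dvd_mult_iff[OF prime_elem_padic] by blast
  have "of_nat CARD('p) * of_nat CARD('p) ^ n dvd of_nat CARD('p) * (x * z)"
    using Suc.prems by (simp add: z mult_ac)
  then have "of_nat CARD('p) ^ n dvd x * z" by (simp only: dvd_mult_cancel_left) auto
  then show ?case using Suc.IH[of z] by (simp add: z)
qed simp

text \<open>One factor p is split off at a time by \<open>padic_dvd_iff\<close>; dividing by p
  lowers the level of the vanishing residue by one.\<close>

lemma padic_power_dvd_iff:
  "of_nat CARD('p) ^ n dvd (x :: 'p::prime_card padic_int) \<longleftrightarrow> Rep_padic_int x n = 0"
proof
  assume "of_nat CARD('p) ^ n dvd x"
  then obtain y where "x = of_nat (CARD('p) ^ n) * y" by (auto elim: dvdE)
  moreover have "Rep_padic_int (of_nat (CARD('p) ^ n) :: 'p padic_int) n = 0"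
    unfolding padic_of_nat by simp
  ultimately show "Rep_padic_int x n = 0" by (simp only: times_padic_int.rep_eq) simp
next
  show "Rep_padic_int x n = 0 \<Longrightarrow> of_nat CARD('p) ^ n dvd x"
  proof (induction n arbitrary: x)
    case (Suc n)
    have "Rep_padic_int x 1 = 0"
      using padic_mod_le[of 1 "Suc n" x] Suc.prems by simp
    then obtain z where z: "x = of_nat CARD('p) * z"
      unfolding padic_dvd_iff[symmetric] by (elim dvdE)
    have "int CARD('p) * Rep_padic_int z (Suc n) mod int CARD('p) ^ Suc n = 0"
      using Suc.prems by (simp only: z times_padic_int.rep_eq padic_of_nat mod_mult_left_eq)
    then have "int CARD('p) * (Rep_padic_int z (Suc n) mod int CARD('p) ^ n) = 0"
      by (simp only: mult_mod_right power_Suc)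
    then have "Rep_padic_int z n = 0"
      using padic_mod_le[of n "Suc n" z] by simp
    then have "of_nat CARD('p) ^ n dvd z" by (rule Suc.IH)
    then show ?case by (simp add: z)
  qed simp
qed

text \<open>Multiples of p become 1, so \<open>unit_prod b n\<close> is the product of the units
  among b, ..., b + n - 1. Up to the sign (-1)^n it is the quotient of the values of Morita's p-adic
  gamma function at b + n and b.\<close>

definition unit_part :: "'p::prime_card padic_int \<Rightarrow> 'p padic_int" where
  "unit_part x = (if of_nat CARD('p) dvd x then 1 else x)"

definition unit_prod :: "'p::prime_card padic_int \<Rightarrow> nat \<Rightarrow> 'p padic_int" where
  "unit_prod b n = (\<Prod>i<n. unit_part (b + of_nat i))"

text \<open>Both arguments are congruent modulo p, hence fall into the same branch of the
  definition.\<close>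

lemma unit_part_cong:
  fixes x y :: "'p::prime_card padic_int"
  assumes "of_nat CARD('p) ^ n dvd x - y" "0 < n"
  shows "of_nat CARD('p) ^ n dvd unit_part x - unit_part y"
proof -
  have "of_nat CARD('p) dvd x - y"
    using assms dvd_trans[OF dvd_power[of n "of_nat CARD('p) :: 'p padic_int"]] by simp
  then have "of_nat CARD('p) dvd (x - y) + y \<longleftrightarrow> of_nat CARD('p) dvd y"
    by (rule dvd_add_right_iff)
  then have "of_nat CARD('p) dvd x \<longleftrightarrow> of_nat CARD('p) dvd y" by simp
  then show ?thesis using assms(1) by (simp add: unit_part_def)
qed

lemma not_dvd_unit_prod: "\<not> of_nat CARD('p) dvd unit_prod (b :: 'p::prime_card padic_int) n"
proof -
  have "\<not> of_nat CARD('p) dvd unit_part (x :: 'p padic_int)" for x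
    using prime_elem_not_unit[OF prime_elem_padic[where 'p='p]] by (simp add: unit_part_def)
  then show ?thesis
    using prime_elem_not_unit[OF prime_elem_padic[where 'p='p]]
    by (induction n) (auto simp: unit_prod_def prime_elem_dvd_mult_iff[OF prime_elem_padic])
qed

text \<open>Moving the start by one trades the first factor for the one n places later, and these
  two are congruent because p^s divides n.\<close>

lemma unit_prod_shift:
  fixes b :: "'p::prime_card padic_int"
  assumes "CARD('p) ^ s dvd n" "0 < s"
  shows "of_nat CARD('p) ^ s dvd unit_prod (b + of_nat m) n - unit_prod b n"
proof (induction m)
  case (Suc m)
  let ?c = "b + of_nat m" and ?P = "of_nat CARD('p) ^ s :: 'p padic_int"
  have "?P dvd unit_prod (?c + 1) n - unit_prod ?c n"
  proof (cases n)
    case (Suc k)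
    have l: "unit_prod ?c n = unit_part ?c * (\<Prod>i<k. unit_part (?c + 1 + of_nat i))"
      unfolding unit_prod_def Suc by (subst prod.lessThan_Suc_shift) (simp add: add_ac)
    have r: "unit_prod (?c + 1) n = unit_part (?c + of_nat n) * (\<Prod>i<k. unit_part (?c + 1 + of_nat i))"
      unfolding unit_prod_def Suc by (simp add: add_ac)
    obtain c where "n = CARD('p) ^ s * c" using assms(1) by (elim dvdE)
    then have "?P dvd of_nat n" by simp
    then have "?P dvd unit_part (?c + of_nat n) - unit_part ?c"
      using unit_part_cong[of s "?c + of_nat n" ?c] assms(2) by simp
    then show ?thesis by (simp only: l r left_diff_distrib[symmetric] dvd_mult2)
  qed (simp add: unit_prod_def)
  then have "?P dvd (unit_prod (?c + 1) n - unit_prod ?c n) + (unit_prod ?c n - unit_prod b n)"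
    using Suc.IH by (rule dvd_add)
  then show ?case by (simp add: add_ac)
qed simp

lemma padic_residue_nat_dvd:
  fixes b :: "'p::prime_card padic_int"
  shows "of_nat CARD('p) ^ s dvd b - of_nat (nat (Rep_padic_int b s))"
proof -
  have "Rep_padic_int (of_nat (nat (Rep_padic_int b s)) :: 'p padic_int) s = Rep_padic_int b s"
    unfolding padic_of_nat using padic_bounds[of b s] by simp
  then show ?thesis by (simp only: padic_power_dvd_iff minus_padic_int.rep_eq) simp
qed

text \<open>The n consecutive arguments meet every residue class modulo p^s equally often, so the
  starting point does not matter.\<close>

lemma unit_prod_cong:
  fixes a b :: "'p::prime_card padic_int"
  assumes "CARD('p) ^ s dvd n" "0 < s"
  shows "of_nat CARD('p) ^ s dvd unit_prod a n - unit_prod b n"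
proof -
  let ?P = "of_nat CARD('p) ^ s :: 'p padic_int"
  \<comment> \<open>The start 0 is the common reference: \<open>c\<close> is first replaced by a
    natural number in its class, from which \<open>unit_prod_shift\<close> leads to 0.\<close>
  have *: "?P dvd unit_prod c n - unit_prod 0 n" for c :: "'p padic_int"
  proof -
    define m where "m = nat (Rep_padic_int c s)"
    have "?P dvd c - of_nat m" unfolding m_def by (rule padic_residue_nat_dvd)
    then have u: "?P dvd unit_part (c + of_nat i) - unit_part (of_nat m + of_nat i)" for i
      using unit_part_cong[of s "c + of_nat i" "of_nat m + of_nat i"] assms(2) by simp
    have "?P dvd unit_prod c k - unit_prod (of_nat m) k" for k
    proof (induction k)
      case (Suc k)
      have "unit_prod c (Suc k) - unit_prod (of_nat m) (Suc k) =
        (unit_prod c k - unit_prod (of_nat m) k) * unit_part (c + of_nat k) +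
        unit_prod (of_nat m) k * (unit_part (c + of_nat k) - unit_part (of_nat m + of_nat k))"
        by (simp add: unit_prod_def algebra_simps)
      then show ?case
        using dvd_add[OF dvd_mult2[OF Suc] dvd_mult[OF u[of k]]] by simp
    qed (simp add: unit_prod_def)
    from dvd_add[OF this[of n] unit_prod_shift[OF assms, of 0 m]] show ?thesis by simp
  qed
  show ?thesis using dvd_diff[OF *[of a] *[of b]] by simp
qed

text \<open>In each block of p consecutive factors exactly the one at position l is a multiple of p;
  in block number k it equals p (b' + k). All other factors are units and are collected in
  \<open>unit_prod\<close>.\<close>

lemma pochhammer_split:
  fixes b b' :: "'p::prime_card padic_int"
  assumes l: "l < CARD('p)" and b: "b + of_nat l = of_nat CARD('p) * b'"
  shows "pochhammer b (CARD('p) * k) = of_nat CARD('p) ^ k * pochhammer b' k * unit_prod b (CARD('p) * k)"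
proof (induction k)
  case 0
  then show ?case by (simp add: unit_prod_def)
next
  case (Suc k)
  let ?p = "CARD('p)"
  define c where "c = b + of_nat (?p * k)"
  have dvd: "of_nat ?p dvd c + of_nat i \<longleftrightarrow> i = l" if "i < ?p" for i
  proof -
    have "c + of_nat i = (b + of_nat i) + of_nat ?p * of_nat k" by (simp add: c_def)
    then have "of_nat ?p dvd c + of_nat i \<longleftrightarrow> of_nat ?p dvd b + of_nat i"
      by (simp only: dvd_add_times_triv_right_iff mult.commute)
    moreover have "of_nat ?p dvd b + of_nat l" by (simp add: b)
    ultimately show ?thesis using dwork_digit_ex1[of b] l that by blast
  qed
  have "pochhammer c ?p = (\<Prod>i<?p. c + of_nat i)"
    by (simp add: pochhammer_prod atLeast0LessThan)
  also have "\<dots> = (c + of_nat l) * (\<Prod>i\<in>{..<?p} - {l}. c + of_nat i)"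
    using l by (subst prod.remove[of _ l]) auto
  also have "(\<Prod>i\<in>{..<?p} - {l}. c + of_nat i) = (\<Prod>i\<in>{..<?p} - {l}. unit_part (c + of_nat i))"
    by (rule prod.cong) (auto simp: unit_part_def dvd)
  \<comment> \<open>The factor at position l has unit part 1, so it may be put back.\<close>
  also have "\<dots> = unit_prod c ?p"
    unfolding unit_prod_def using l
    by (subst (2) prod.remove[of _ l]) (auto simp: unit_part_def dvd)
  also have "c + of_nat l = of_nat ?p * (b' + of_nat k)"
    using b by (simp add: c_def algebra_simps)
  finally have poch: "pochhammer c ?p = of_nat ?p * (b' + of_nat k) * unit_prod c ?p" .
  have u: "unit_prod b (m + n) = unit_prod b m * unit_prod (b + of_nat m) n" for m n
    by (induction n) (simp_all add: unit_prod_def add_ac mult.assoc)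
  have "pochhammer b (?p * Suc k) = pochhammer b (?p * k) * pochhammer c ?p"
    using pochhammer_product'[of b "?p * k" ?p] by (simp only: c_def mult_Suc_right add.commute)
  also have "\<dots> = of_nat ?p ^ Suc k * pochhammer b' (Suc k) * (unit_prod b (?p * k) * unit_prod c ?p)"
    unfolding Suc.IH poch by (simp add: pochhammer_rec' mult_ac)
  also have "unit_prod b (?p * k) * unit_prod c ?p = unit_prod b (?p * Suc k)"
    using u[of "?p * k" ?p] by (simp only: c_def mult_Suc_right add.commute)
  finally show ?case .
qed

section \<open>Congruences for the coefficients\<close>

lemma fps_of_nat_power_dvd_iff:
  "of_nat q ^ n dvd (f :: 'a::comm_ring_1 fps) \<longleftrightarrow> (\<forall>k. of_nat q ^ n dvd fps_nth f k)"
proof -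
  have q: "(of_nat q ^ n :: 'a fps) = fps_const (of_nat q ^ n)"
    by (metis fps_const_power fps_of_nat)
  show ?thesis
  proof
    assume "of_nat q ^ n dvd f"
    then show "\<forall>k. of_nat q ^ n dvd fps_nth f k" by (auto simp: q elim!: dvdE)
  next
    assume "\<forall>k. of_nat q ^ n dvd fps_nth f k"
    then obtain g where "\<And>k. fps_nth f k = of_nat q ^ n * g k" unfolding dvd_def by metis
    then have "f = of_nat q ^ n * Abs_fps g" by (intro fps_ext) (simp add: q)
    then show "of_nat q ^ n dvd f" by simp
  qed
qed

lemma padic_dvd_of_nat_iff:
  "of_nat CARD('p) dvd (of_nat k :: 'p::prime_card padic_int) \<longleftrightarrow> CARD('p) dvd k"
  unfolding padic_dvd_iff padic_of_nat power_one_right of_nat_mod[symmetric]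
  by (simp add: mod_eq_0_iff_dvd)

lemma prime_power_decompose:
  assumes "0 < k"
  obtains s w where "k = CARD('p::prime_card) ^ s * w" "\<not> CARD('p) dvd w"
proof -
  have "\<not> is_unit CARD('p)" using prime_card[where 'a='p] by (metis not_prime_unit)
  from multiplicity_decompose'[OF _ this, of k] assms that show ?thesis by auto
qed

text \<open>Splitting both the numerator and the factorial \<open>pochhammer 1 (p * k)\<close>
  produces the same power p^k, which cancels.\<close>

lemma hyp_coeff_mult:
  fixes b b' :: "'p::prime_card padic_int"
  assumes "l < CARD('p)" "b + of_nat l = of_nat CARD('p) * b'"
  shows "unit_prod 1 (CARD('p) * k) * hyp_coeff b (CARD('p) * k) =
    hyp_coeff b' k * unit_prod b (CARD('p) * k)"
proof -
  let ?p = "CARD('p)"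
  let ?c = "of_nat ?p ^ k * fact k :: 'p padic_int"
  have p: "0 < ?p" using prime_gt_0_nat[OF prime_card] .
  \<comment> \<open>The number 1 has digit p - 1 and Dwork prime 1.\<close>
  then have "(1 :: 'p padic_int) + of_nat (?p - 1) = of_nat ?p * 1" by (simp add: of_nat_diff)
  from pochhammer_split[OF _ this] p
  have "fact (?p * k) = ?c * (unit_prod 1 (?p * k) :: 'p padic_int)"
    by (simp add: pochhammer_fact)
  then have "?c * (unit_prod 1 (?p * k) * hyp_coeff b (?p * k)) = pochhammer b (?p * k)"
    by (simp only: fact_mult_hyp_coeff[symmetric] mult.assoc)
  also have "\<dots> = ?c * (hyp_coeff b' k * unit_prod b (?p * k))"
    unfolding pochhammer_split[OF assms] by (simp only: fact_mult_hyp_coeff[symmetric] mult.assoc)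
  finally show ?thesis using p by simp
qed

text \<open>By \<open>hyp_coeff_mult\<close> the difference is, up to a unit, the coefficient for b'
  times a difference of two unit products of length p k, which p^(s+1) divides. The factor
  \<open>c\<close> supplies the divisibility that is missing when s is small.\<close>

lemma hyp_coeff_cong:
  fixes b b' c :: "'p::prime_card padic_int"
  assumes "l < CARD('p)" "b + of_nat l = of_nat CARD('p) * b'"
    and "CARD('p) ^ s dvd k"
    and "of_nat CARD('p) ^ n dvd of_nat CARD('p) ^ Suc s * (c * hyp_coeff b' k)"
  shows "of_nat CARD('p) ^ n dvd c * (hyp_coeff b (CARD('p) * k) - hyp_coeff b' k)"
proof (rule padic_power_dvd_cancel[OF _ not_dvd_unit_prod])
  let ?p = "CARD('p)" let ?u = "\<lambda>b :: 'p padic_int. unit_prod b (?p * k)"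
  have "?p ^ Suc s dvd ?p * k" using assms(3) by simp
  then have "of_nat ?p ^ Suc s dvd ?u b - ?u 1" by (rule unit_prod_cong) simp
  then have "of_nat ?p ^ Suc s * (c * hyp_coeff b' k) dvd (?u b - ?u 1) * (c * hyp_coeff b' k)"
    by (rule mult_dvd_mono) simp
  also have "(?u b - ?u 1) * (c * hyp_coeff b' k) =
      ?u 1 * (c * (hyp_coeff b (?p * k) - hyp_coeff b' k))"
    using hyp_coeff_mult[OF assms(1,2), of k] by (simp add: algebra_simps)
  finally show "of_nat ?p ^ n dvd ?u 1 * (c * (hyp_coeff b (?p * k) - hyp_coeff b' k))"
    using assms(4) dvd_trans by blast
qed

lemma fps_nth_compose_X_prime:
  "fps_nth (f oo fps_X ^ CARD('p::prime_card)) k =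
    (if CARD('p) dvd k then fps_nth (f :: 'a::comm_ring_1 fps) (k div CARD('p)) else 0)"
  using prime_gt_0_nat[OF prime_card[where 'a='p]] by (simp add: fps_nth_compose_X_power)

text \<open>Since p^n divides y, it divides i times the i-th coefficient of F_y and of F_(py). For i
  prime to p this settles the coefficient itself; for multiples of p the factors p in the index are
  made up for by \<open>hyp_coeff_cong\<close>.\<close>

lemma hyp_series_prime_mult_cong:
  fixes y :: "'p::prime_card padic_int"
  assumes y: "of_nat CARD('p) ^ n dvd y"
  shows "of_nat CARD('p) ^ n dvd
    hyp_series (of_nat CARD('p) * y) - (hyp_series y oo fps_X ^ CARD('p))"
  unfolding fps_of_nat_power_dvd_iff
proof
  fix k
  let ?p = "CARD('p)" let ?P = "of_nat ?p :: 'p padic_int"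
  have absorb: "?P ^ n dvd of_nat i * hyp_coeff z i" if "?P ^ n dvd z" "0 < i" for z i
    using Suc_mult_hyp_coeff_shift[of "i - 1" z] that by simp
  show "?P ^ n dvd fps_nth (hyp_series (?P * y) - (hyp_series y oo fps_X ^ ?p)) k"
  proof (cases "?p dvd k")
    case False
    then have "?P ^ n dvd of_nat k * hyp_coeff (?P * y) k"
      using y by (intro absorb) (auto intro: Nat.gr0I)
    then have "?P ^ n dvd hyp_coeff (?P * y) k"
      by (rule padic_power_dvd_cancel) (simp add: padic_dvd_of_nat_iff False)
    then show ?thesis using False by (simp add: fps_nth_compose_X_prime)
  next
    case True
    then obtain j where k: "k = ?p * j" by (elim dvdE)
    have "?P ^ n dvd 1 * (hyp_coeff (?P * y) (?p * j) - hyp_coeff y j)"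
    proof (cases "j = 0")
      case False
      then obtain s w where j: "j = ?p ^ s * w" "\<not> ?p dvd w"
        using prime_power_decompose[where 'p='p, of j] by auto
      have "?P ^ n dvd of_nat w * (?P ^ s * hyp_coeff y j)"
        using absorb[OF y, of j] False by (simp add: j mult_ac)
      then have "?P ^ n dvd ?P ^ s * hyp_coeff y j"
        by (rule padic_power_dvd_cancel) (simp add: padic_dvd_of_nat_iff j)
      then have "?P ^ n dvd ?P ^ Suc s * (1 * hyp_coeff y j)"
        by (simp add: mult.assoc)
      then show ?thesis
        using j prime_gt_0_nat[OF prime_card[where 'a='p]]
        \<comment> \<open>Here p y has digit 0 and Dwork prime y.\<close>
        by (intro hyp_coeff_cong[where l = 0 and s = s]) simp_all
    qed simp
    then show ?thesis
      using prime_gt_0_nat[OF prime_card[where 'a='p]] by (simp add: fps_nth_compose_X_prime k)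
  qed
qed

text \<open>With r = k - N, the factor (1-b)_r is (-1)^r (b-r)_r, which joins with (b)_N to (b-r)_k.
  The result contains no division by k, so its factors can be compared separately modulo powers of
  p.\<close>

lemma trunc_quotient_nth_closed:
  fixes b :: "'p::prime_card padic_int"
  assumes "0 < N" "N \<le> k"
  shows "fps_nth (fps_of_poly (fps_trunc N (hyp_series b)) * hyp_series (- b)) k =
    (- 1) ^ Suc (k - N) * of_nat ((k - 1) choose (N - 1)) * hyp_coeff (b - of_nat (k - N)) k"
proof -
  obtain r where k: "k = r + N" using assms(2) le_Suc_ex by (metis add.commute)
  then have r: "k - N = r" and k0: "0 < k" using assms(1) by simp_all
  let ?D = "fps_nth (fps_of_poly (fps_trunc N (hyp_series b)) * hyp_series (- b)) k"
  let ?h = "hyp_coeff (b - of_nat r) k"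
  \<comment> \<open>Multiplying by \<open>?f\<close> clears k and the denominators of both
    coefficients.\<close>
  let ?f = "of_nat (k * fact N * fact r) :: 'p padic_int"
  have "pochhammer (- (b - 1)) r = (- 1) ^ r * pochhammer (b - of_nat r) r"
    by (subst pochhammer_minus) simp
  then have "pochhammer (1 - b) r * pochhammer b N = (- 1) ^ r * (fact k * ?h)"
    using pochhammer_product'[of "b - of_nat r" r N]
    by (simp add: fact_mult_hyp_coeff k mult.assoc)
  moreover have "of_nat k * ?D = - (of_nat N * hyp_coeff b N * hyp_coeff (1 - b) r)"
    using trunc_quotient_nth[of N k b] assms k0 by (simp add: r)
  ultimately have "?f * ?D = - (of_nat N * ((- 1) ^ r * (fact k * ?h)))"
    by (simp only: of_nat_mult of_nat_fact fact_mult_hyp_coeff[symmetric])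
      (simp add: algebra_simps)
  also have "\<dots> = (- 1) ^ Suc r * of_nat (N * fact k) * ?h" by simp
  also have "N * fact k = fact N * fact r * (N * (k choose N))"
    using binomial_fact_lemma[of N k] assms(2) by (simp add: r mult_ac)
  also have "N * (k choose N) = k * ((k - 1) choose (N - 1))"
    by (rule times_binomial_minus1_eq[OF assms(1)])
  finally have "?f * ?D = ?f * ((- 1) ^ Suc r * of_nat ((k - 1) choose (N - 1)) * ?h)"
    by (simp add: mult_ac)
  moreover have "?f \<noteq> 0" using k0 by simp
  ultimately show ?thesis unfolding r by (metis mult_left_cancel)
qed

section \<open>Binomial coefficients at multiples of prime powers\<close>

lemma of_nat_binomial_eq_hyp_coeff:
  assumes "N \<le> k"
  shows "of_nat (k choose N) = hyp_coeff (of_nat (k - N) + 1 :: 'p::prime_card padic_int) N"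
proof (rule hyp_coeff_unique)
  let ?F = "fact (k - N) :: 'p padic_int"
  have "?F * (fact N * of_nat (k choose N)) = of_nat (fact k)"
    unfolding binomial_fact_lemma[OF assms, symmetric] by simp
  also have "\<dots> = ?F * pochhammer (of_nat (k - N) + 1) N"
    unfolding of_nat_fact unfolding pochhammer_fact
    using pochhammer_product'[of "1 :: 'p padic_int" "k - N" N] assms by (simp add: add.commute)
  finally show "fact N * of_nat (k choose N) = pochhammer (of_nat (k - N) + 1 :: 'p padic_int) N"
    by simp
qed

text \<open>As coefficients of a binomial series, the two binomials are related by
  \<open>hyp_coeff_mult\<close>: their ratio is that of two unit products of length p^(n+1), which
  agree modulo p^(n+1).\<close>

lemma binomial_prime_power_cong:
  fixes n :: nat
  defines "M \<equiv> CARD('p::prime_card) ^ n"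
  assumes k: "M \<le> k"
  shows "of_nat CARD('p) ^ Suc n dvd
    (of_nat ((CARD('p) * k - 1) choose (CARD('p) * M - 1)) :: 'p padic_int) -
    of_nat ((k - 1) choose (M - 1))"
proof (rule padic_power_dvd_cancel[OF _ not_dvd_unit_prod])
  let ?p = "CARD('p)"
  have p: "0 < ?p" using prime_gt_0_nat[OF prime_card] .
  have M: "0 < M" using p by (simp add: M_def)
  define b where "b = (of_nat (?p * k - ?p * M) + 1 :: 'p padic_int)"
  let ?U = "unit_prod 1 (?p * M) :: 'p padic_int" and ?V = "unit_prod b (?p * M)"
  define C1 where "C1 = (of_nat ((?p * k - 1) choose (?p * M - 1)) :: 'p padic_int)"
  define C0 where "C0 = (of_nat ((k - 1) choose (M - 1)) :: 'p padic_int)"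
  \<comment> \<open>The digit of \<open>b\<close> is p - 1 and its Dwork prime is k - M + 1.\<close>
  have "b + of_nat (?p - 1) = of_nat ?p * (of_nat (k - M) + 1)"
    using p by (simp add: b_def of_nat_diff flip: diff_mult_distrib2) (simp add: algebra_simps)
  from hyp_coeff_mult[OF _ this, of M] p
  have bin: "?U * of_nat ((?p * k) choose (?p * M)) = of_nat (k choose M) * ?V"
    using k by (simp add: of_nat_binomial_eq_hyp_coeff b_def)
  have c1: "of_nat (?p * M) * of_nat ((?p * k) choose (?p * M)) = of_nat (?p * k) * C1"
    unfolding C1_def using times_binomial_minus1_eq[of "?p * M" "?p * k"] p M
    by (metis nat_0_less_mult_iff of_nat_mult)
  have c0: "of_nat M * of_nat (k choose M) = of_nat k * C0"
    unfolding C0_def using times_binomial_minus1_eq[OF M, of k] by (metis of_nat_mult)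
  have "of_nat (?p * k) * (?U * C1) = of_nat (?p * M) * (?U * of_nat ((?p * k) choose (?p * M)))"
    by (subst (1 2) mult.left_commute) (simp only: c1)
  also have "\<dots> = of_nat ?p * ?V * (of_nat M * of_nat (k choose M))"
    unfolding bin by (simp only: of_nat_mult mult_ac)
  also have "\<dots> = of_nat (?p * k) * (C0 * ?V)" by (simp only: c0 of_nat_mult mult_ac)
  finally have "?U * C1 = C0 * ?V" using p k M by simp
  then have "?U * (C1 - C0) = C0 * (?V - ?U)" by (simp add: algebra_simps)
  moreover have "of_nat ?p ^ Suc n dvd ?V - ?U"
    by (rule unit_prod_cong) (simp_all add: M_def)
  ultimately show "of_nat ?p ^ Suc n dvd ?U * (C1 - C0)" by simp
qed

text \<open>Absorption gives k C(k-1, M-1) = M C(k, M), a multiple of M; the part of k prime to p is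
  then cancelled.\<close>

lemma binomial_prime_power_dvd:
  fixes n :: nat
  defines "M \<equiv> CARD('p::prime_card) ^ n"
  assumes k: "k = CARD('p) ^ s * w" "\<not> CARD('p) dvd w"
  shows "of_nat CARD('p) ^ n dvd
    of_nat CARD('p) ^ s * (of_nat ((k - 1) choose (M - 1)) :: 'p padic_int)"
proof (rule padic_power_dvd_cancel)
  have "0 < M" using prime_gt_0_nat[OF prime_card[where 'a='p]] by (simp add: M_def)
  then have "M dvd k * ((k - 1) choose (M - 1))"
    by (metis dvd_triv_left times_binomial_minus1_eq)
  then obtain c where "k * ((k - 1) choose (M - 1)) = M * c" by (elim dvdE)
  then have "(of_nat k * of_nat ((k - 1) choose (M - 1)) :: 'p padic_int) = of_nat M * of_nat c"
    by (metis of_nat_mult)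
  then show "of_nat CARD('p) ^ n dvd
      of_nat w * (of_nat CARD('p) ^ s * (of_nat ((k - 1) choose (M - 1)) :: 'p padic_int))"
    by (simp add: k(1) M_def mult_ac)
  show "\<not> of_nat CARD('p) dvd (of_nat w :: 'p padic_int)"
    by (simp add: padic_dvd_of_nat_iff k)
qed

section \<open>Dwork's congruence\<close>

text \<open>The signs differ only for p = 2 and odd k - M. Then their difference supplies one factor
  2, and for positive n the index k is odd, so the binomial supplies 2^n.\<close>

lemma sign_binomial_dvd:
  fixes n :: nat
  defines "M \<equiv> CARD('p::prime_card) ^ n"
  assumes "M \<le> k" "0 < k"
  shows "of_nat CARD('p) ^ Suc n dvd
    ((- 1) ^ (CARD('p) * (k - M)) - (- 1) ^ (k - M)) *
    (of_nat ((k - 1) choose (M - 1)) :: 'p padic_int)"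
proof (cases "even (k - M) \<or> odd CARD('p)")
  case True
  then have "(- 1) ^ (CARD('p) * (k - M)) = ((- 1) ^ (k - M) :: 'p padic_int)"
    by (auto simp: minus_one_power_iff)
  then show ?thesis by simp
next
  case False
  then have "\<not> 2 < CARD('p)" using prime_odd_nat[OF prime_card[where 'a='p]] by blast
  with prime_ge_2_nat[OF prime_card[where 'a='p]] have two: "CARD('p) = 2" by linarith
  have "of_nat CARD('p) ^ n dvd (of_nat ((k - 1) choose (M - 1)) :: 'p padic_int)"
  proof (cases "n = 0")
    case nz: False
    then have "even M" by (simp add: M_def two)
    then have "odd k" using False assms(2) by auto
    then show ?thesis
      using binomial_prime_power_dvd[where 'p='p, of k 0 k n] by (simp add: two M_def)
  qed simp
  moreover have "(of_nat CARD('p) :: 'p padic_int) dvd (- 1) ^ (CARD('p) * (k - M)) - (- 1) ^ (k - M)"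
    using False by (simp add: two)
  ultimately show ?thesis by (simp only: power_Suc mult_dvd_mono)
qed

text \<open>Coefficients are compared one by one. If p does not divide k, already k times the
  coefficient is a multiple of p^(n+1). If k = p j, the two closed forms differ in the binomial, the
  series coefficient and the sign, and each exchange costs a multiple of p^(n+1).\<close>

lemma trunc_quotient_cong:
  fixes b b' :: "'p::prime_card padic_int"
  assumes l: "l < CARD('p)" and b: "b + of_nat l = of_nat CARD('p) * b'"
  shows "of_nat CARD('p) ^ Suc n dvd
    fps_of_poly (fps_trunc (CARD('p) ^ Suc n) (hyp_series b)) * hyp_series (- b) -
    ((fps_of_poly (fps_trunc (CARD('p) ^ n) (hyp_series b')) * hyp_series (- b')) oo fps_X ^ CARD('p))"
  unfolding fps_of_nat_power_dvd_iff
proof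
  fix k
  let ?p = "CARD('p)" let ?P = "of_nat ?p :: 'p padic_int"
  define M where "M = ?p ^ n"
  have p: "0 < ?p" using prime_gt_0_nat[OF prime_card] .
  then have M: "0 < M" by (simp add: M_def)
  have N: "?p ^ Suc n = ?p * M" by (simp add: M_def)
  let ?D = "fps_of_poly (fps_trunc (?p * M) (hyp_series b)) * hyp_series (- b)"
  let ?E = "fps_of_poly (fps_trunc M (hyp_series b')) * hyp_series (- b')"
  have low: "fps_nth (fps_of_poly (fps_trunc m (hyp_series c)) * hyp_series (- c)) i = 0"
    if "0 < i" "i < m" for m i and c :: "'p padic_int"
    using trunc_quotient_nth[of m i c] that by simp
  have "?P ^ Suc n dvd fps_nth (?D - (?E oo fps_X ^ ?p)) k"
  proof (cases "?p dvd k")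
    case False
    then have "0 < k" by (auto intro: Nat.gr0I)
    then have "?P ^ Suc n dvd of_nat k * fps_nth ?D k"
      using trunc_quotient_nth[of "?p * M" k b] p M by (simp add: M_def)
    then have "?P ^ Suc n dvd fps_nth ?D k"
      by (rule padic_power_dvd_cancel) (simp add: padic_dvd_of_nat_iff False)
    then show ?thesis using False by (simp add: fps_nth_compose_X_prime del: fps_mult_nth)
  next
    case True
    then obtain j where k: "k = ?p * j" by (elim dvdE)
    have "?P ^ Suc n dvd fps_nth ?D (?p * j) - fps_nth ?E j"
    proof (cases "M \<le> j")
      case False
      \<comment> \<open>Below the truncation degree both coefficients are 1 at index 0 and 0
        elsewhere.\<close>
      then show ?thesis
        using p M trunc_quotient_nth_0[of "?p * M" b] trunc_quotient_nth_0[of M b'] low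
        by (cases "j = 0") simp_all
    next
      case True
      then obtain r where j: "j = r + M" using le_Suc_ex by (metis add.commute)
      then have r: "j - M = r" "?p * j - ?p * M = ?p * r" and j0: "0 < j"
        using M by (simp_all add: algebra_simps)
      \<comment> \<open>The shifted parameter \<open>c\<close> again has digit l, and its Dwork
        prime is \<open>c'\<close>.\<close>
      define c where "c = b - of_nat (?p * r)"
      define c' where "c' = b' - of_nat r"
      have c: "c + of_nat l = ?P * c'" using b by (simp add: c_def c'_def algebra_simps)
      define B1 where "B1 = (of_nat ((?p * j - 1) choose (?p * M - 1)) :: 'p padic_int)"
      define B0 where "B0 = (of_nat ((j - 1) choose (M - 1)) :: 'p padic_int)"
      let ?e = "(- 1) ^ Suc (?p * r) :: 'p padic_int" and ?e' = "(- 1) ^ Suc r :: 'p padic_int"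
      have D: "fps_nth ?D (?p * j) = ?e * B1 * hyp_coeff c (?p * j)"
        using trunc_quotient_nth_closed[of "?p * M" "?p * j" b] p M True
        by (simp add: r B1_def c_def)
      have E: "fps_nth ?E j = ?e' * B0 * hyp_coeff c' j"
        using trunc_quotient_nth_closed[of M j b'] M True by (simp add: r B0_def c'_def)
      obtain s w where w: "j = ?p ^ s * w" "\<not> ?p dvd w"
        using prime_power_decompose[where 'p='p, OF j0] .
      have "?P ^ n dvd ?P ^ s * B0"
        unfolding B0_def M_def using w by (rule binomial_prime_power_dvd)
      \<comment> \<open>The binomial \<open>B0\<close> carries the powers of p that j lacks, so it
        is the multiplier in \<open>hyp_coeff_cong\<close>.\<close>
      then have "?P ^ Suc n dvd ?P ^ Suc s * (B0 * hyp_coeff c' j)"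
        by (simp add: mult.assoc[symmetric] dvd_mult2)
      then have 1: "?P ^ Suc n dvd B0 * (hyp_coeff c (?p * j) - hyp_coeff c' j)"
        using w(1) by (intro hyp_coeff_cong[OF l c]) auto
      have 2: "?P ^ Suc n dvd B1 - B0"
        unfolding B1_def B0_def M_def using True unfolding M_def by (rule binomial_prime_power_cong)
      have 3: "?P ^ Suc n dvd ((- 1) ^ (?p * r) - (- 1) ^ r) * B0"
        using sign_binomial_dvd[where 'p='p, of n j] True j0 by (simp add: M_def[symmetric] r B0_def)
      have "fps_nth ?D (?p * j) - fps_nth ?E j =
          ?e * hyp_coeff c (?p * j) * (B1 - B0) + ?e * (B0 * (hyp_coeff c (?p * j) - hyp_coeff c' j))
          - ((- 1) ^ (?p * r) - (- 1) ^ r) * B0 * hyp_coeff c' j"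
        unfolding D E by (simp add: algebra_simps)
      then show ?thesis
        by (simp only: dvd_diff[OF dvd_add[OF dvd_mult[OF 2] dvd_mult[OF 1]] dvd_mult2[OF 3]])
    qed
    then show ?thesis using p by (simp add: fps_nth_compose_X_prime k del: fps_mult_nth)
  qed
  then show "?P ^ Suc n dvd fps_nth (fps_of_poly (fps_trunc (?p ^ Suc n) (hyp_series b)) * hyp_series (- b) -
    ((fps_of_poly (fps_trunc (?p ^ n) (hyp_series b')) * hyp_series (- b')) oo fps_X ^ ?p)) k"
    by (simp only: N M_def)
qed

lemma dwork_digit_eqI:
  assumes "l < CARD('p)" "of_nat CARD('p) dvd (b :: 'p::prime_card padic_int) + of_nat l"
  shows "dwork_digit b = l"
  unfolding dwork_digit_def using assms dwork_digit_ex1[of b] by (intro the1_equality) auto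

lemma dwork_digit_less: "dwork_digit (b :: 'p::prime_card padic_int) < CARD('p)"
  and mult_dwork_prime: "b + of_nat (dwork_digit b) = of_nat CARD('p) * dwork_prime b"
  using theI'[OF dwork_digit_ex1[of b]]
  by (simp_all add: dwork_prime_def dwork_digit_def[symmetric])

lemma compose_X_prime_mult:
  "((f * g) oo fps_X ^ CARD('p::prime_card)) =
    (f oo fps_X ^ CARD('p)) * ((g :: 'a::idom fps) oo fps_X ^ CARD('p))"
  using prime_gt_0_nat[OF prime_card[where 'a='p]] by (intro fps_compose_mult_distrib) simp

text \<open>The inverse of F_b'(t^p) is F_(-b')(t^p), because substitution of t^p is
  multiplicative.\<close>

lemma dwork_series_eq_mult:
  "dwork_series (b :: 'p::prime_card padic_int) =
    hyp_series b * (hyp_series (- dwork_prime b) oo fps_X ^ CARD('p))"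
proof -
  have "dwork_denom b * (hyp_series (- dwork_prime b) oo fps_X ^ CARD('p)) = 1"
    unfolding dwork_denom_def compose_X_prime_mult[symmetric] by (simp add: hyp_series_mult)
  then have "dwork_series b = (dwork_series b * dwork_denom b) *
      (hyp_series (- dwork_prime b) oo fps_X ^ CARD('p))" by (simp add: mult.assoc)
  then show ?thesis by (simp only: dwork_series_eq)
qed

text \<open>This is \<open>trunc_quotient_cong\<close> multiplied by F_b, which turns P F_(-b) back
  into P.\<close>

theorem dwork_congruence:
  fixes b :: "'p::prime_card padic_int"
  assumes "0 < n"
  shows "of_nat CARD('p) ^ n dvd
    dwork_series b * fps_of_poly (fps_trunc (CARD('p) ^ n) (dwork_denom b)) -
    fps_of_poly (fps_trunc (CARD('p) ^ n) (hyp_series b))"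
proof -
  obtain m where n: "n = Suc m" using assms gr0_conv_Suc by blast
  let ?p = "CARD('p)" and ?b = "dwork_prime b"
  let ?P = "fps_of_poly (fps_trunc (?p ^ n) (hyp_series b))"
  let ?Q = "fps_of_poly (fps_trunc (?p ^ m) (hyp_series ?b))"
  have p: "0 < ?p" using prime_gt_0_nat[OF prime_card] .
  \<comment> \<open>Truncating F_b'(t^p) below p^n in t means truncating F_b' below p^(n-1).\<close>
  have "i div ?p < ?p ^ m \<longleftrightarrow> i < ?p ^ n" for i
    using p by (simp add: div_less_iff_less_mult n mult.commute)
  then have Q: "fps_of_poly (fps_trunc (?p ^ n) (dwork_denom b)) = ?Q oo fps_X ^ ?p"
    by (intro fps_ext) (simp add: coeff_fps_trunc fps_nth_compose_X_prime dwork_denom_def)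
  have "hyp_series b * (?P * hyp_series (- b)) = ?P"
    by (simp add: mult.left_commute hyp_series_mult)
  then have "dwork_series b * fps_of_poly (fps_trunc (?p ^ n) (dwork_denom b)) - ?P =
      - (hyp_series b * (?P * hyp_series (- b) - ((?Q * hyp_series (- ?b)) oo fps_X ^ ?p)))"
    by (simp add: Q dwork_series_eq_mult compose_X_prime_mult algebra_simps)
  then show ?thesis
    using trunc_quotient_cong[OF dwork_digit_less mult_dwork_prime, of m b, folded n] by simp
qed

text \<open>With y = -(b' + m) one has b + p y = -(l + p m). The two terms are then F_b times
  F_y(t^p) and F_b times F_(py)(t), which agree modulo p^n.\<close>

lemma dwork_series_cong_power:
  fixes b :: "'p::prime_card padic_int"
  assumes m: "of_nat CARD('p) ^ n dvd dwork_prime b + of_nat m"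
  shows "of_nat CARD('p) ^ n dvd
    dwork_series b * (1 - fps_X ^ CARD('p)) ^ m - (1 - fps_X) ^ (dwork_digit b + CARD('p) * m)"
proof -
  let ?p = "CARD('p)" and ?b = "dwork_prime b"
  define y where "y = - (?b + of_nat m)"
  have "of_nat ?p ^ n dvd y" using m by (simp add: y_def del: minus_add_distrib)
  note cong = hyp_series_prime_mult_cong[OF this]
  have "((1 - fps_X) ^ m oo fps_X ^ ?p) = ((1 - fps_X) oo fps_X ^ ?p :: 'p padic_int fps) ^ m"
    using prime_gt_0_nat[OF prime_card[where 'a='p]] by (intro fps_compose_power[symmetric]) simp
  then have "(1 - fps_X ^ ?p) ^ m = hyp_series (- of_nat m :: 'p padic_int) oo fps_X ^ ?p"
    using prime_gt_0_nat[OF prime_card[where 'a='p]]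
    by (simp add: hyp_series_minus_of_nat fps_compose_sub_distrib)
  then have 1: "dwork_series b * (1 - fps_X ^ ?p) ^ m = hyp_series b * (hyp_series y oo fps_X ^ ?p)"
    by (simp add: dwork_series_eq_mult mult.assoc hyp_series_mult y_def flip: compose_X_prime_mult)
  have "b + of_nat ?p * y = - of_nat (dwork_digit b + ?p * m)"
    using mult_dwork_prime[of b] by (simp add: y_def algebra_simps)
  then have 2: "(1 - fps_X) ^ (dwork_digit b + ?p * m) = hyp_series b * hyp_series (of_nat ?p * y)"
    by (simp only: hyp_series_mult hyp_series_minus_of_nat)
  have "dwork_series b * (1 - fps_X ^ ?p) ^ m - (1 - fps_X) ^ (dwork_digit b + ?p * m) =
      - (hyp_series b * (hyp_series (of_nat ?p * y) - (hyp_series y oo fps_X ^ ?p)))"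
    unfolding 1 2 by (simp add: algebra_simps)
  then show ?thesis using cong by simp
qed

section \<open>The limit in the completion\<close>

lemma not_prime_dvd_poly:
  fixes g :: "'p::prime_card padic_int poly"
  assumes "poly g 0 = 1"
  shows "\<not> of_nat CARD('p) dvd g"
proof
  assume "of_nat CARD('p) dvd g"
  then have "of_nat CARD('p) dvd poly g 0" by (auto elim!: dvdE)
  then show False
    using assms prime_elem_not_unit[OF prime_elem_padic[where 'p='p]] by simp
qed

text \<open>Cross-multiplication eliminates the power series, leaving a numerator divisible by p^n
  over a denominator that is nonzero modulo p.\<close>

lemma ratfun_pdvd_Fract_diff:
  fixes f g f' g' :: "'p::prime_card padic_int poly"
  assumes "of_nat CARD('p) ^ n dvd \<phi> * fps_of_poly g - fps_of_poly f"
    and "of_nat CARD('p) ^ n dvd \<phi> * fps_of_poly g' - fps_of_poly f'"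
    and g: "\<not> of_nat CARD('p) dvd g" "\<not> of_nat CARD('p) dvd g'"
  shows "ratfun_pdvd n (Fract f g - Fract f' g')"
proof -
  let ?P = "of_nat CARD('p) ^ n :: 'p padic_int"
  have nz: "g \<noteq> 0" "g' \<noteq> 0" using g by auto
  have "\<not> of_nat CARD('p) dvd g * g'"
    using g prime_elem_dvd_mult_iff[OF prime_elem_padic_poly] by blast
  then have R: "Fract h (g * g') \<in> ratfun_ring" for h by (rule ratfun_ringI)
  have "fps_of_poly (f * g' - f' * g) =
      (\<phi> * fps_of_poly g' - fps_of_poly f') * fps_of_poly g -
      (\<phi> * fps_of_poly g - fps_of_poly f) * fps_of_poly g'"
    by (simp add: fps_of_poly_diff fps_of_poly_mult algebra_simps)
  then have "of_nat CARD('p) ^ n dvd fps_of_poly (f * g' - f' * g)"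
    by (simp only: dvd_diff[OF dvd_mult2[OF assms(2)] dvd_mult2[OF assms(1)]])
  then have "?P dvd Polynomial.coeff (f * g' - f' * g) i" for i
    unfolding fps_of_nat_power_dvd_iff fps_of_poly_nth by blast
  then have "[:?P:] dvd f * g' - f' * g" by (subst const_poly_dvd_iff) blast
  moreover have "[:?P:] = of_nat CARD('p) ^ n" by (simp add: of_nat_poly poly_const_pow)
  ultimately obtain h where h: "f * g' - f' * g = of_nat CARD('p) ^ n * h" by (auto elim: dvdE)
  have "Fract f g - Fract f' g' = Fract (of_nat (CARD('p) ^ n) * h) (1 * (g * g'))"
    using nz h by simp
  also have "\<dots> = Fract (of_nat (CARD('p) ^ n)) 1 * Fract h (g * g')"
    by (simp only: mult_fract)
  also have "Fract (of_nat (CARD('p) ^ n)) 1 = (of_nat CARD('p) ^ n :: 'p ratfun)"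
    by (rule trans[OF Fract_of_nat_eq of_nat_power])
  finally show ?thesis unfolding ratfun_pdvd_def using R by blast
qed

section \<open>Divisibility by powers of p in the completion\<close>

lemma of_nat_prime_ratfun_nonzero: "(of_nat CARD('p::prime_card) :: 'p ratfun) \<noteq> 0"
proof
  assume "(of_nat CARD('p) :: 'p ratfun) = 0"
  then have "Fract (of_nat CARD('p)) 1 = (Fract 0 1 :: 'p ratfun)"
    by (simp only: Fract_of_nat_eq[symmetric] fract_collapse)
  then have "(of_nat CARD('p) :: 'p padic_int poly) = 0" by (simp add: eq_fract)
  then show False using prime_elem_padic_poly[where 'p='p] by auto
qed

lemma ratfun_pdvd_mult_power_iff:
  "ratfun_pdvd (k + j) (of_nat CARD('p) ^ k * x) \<longleftrightarrow> ratfun_pdvd j (x :: 'p::prime_card ratfun)"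
  using of_nat_prime_ratfun_nonzero[where 'p='p]
  by (simp add: ratfun_pdvd_def power_add mult.assoc)

lemma of_nat_power_eq_of_ratfun:
  "of_nat CARD('p) ^ k = of_ratfun (of_nat CARD('p) ^ k :: 'p::prime_card ratfun)"
  by (simp add: of_ratfun_power ratfun_ring_of_nat of_ratfun_of_nat)

text \<open>A cofactor in the completion is a Cauchy sequence; a single term of it, far enough out,
  already shows divisibility among rational functions.\<close>

lemma of_nat_power_dvd_of_ratfun_iff:
  fixes x :: "'p::prime_card ratfun"
  assumes x: "x \<in> ratfun_ring"
  shows "of_nat CARD('p) ^ k dvd of_ratfun x \<longleftrightarrow> ratfun_pdvd k x"
proof
  let ?P = "of_nat CARD('p) ^ k :: 'p ratfun"
  have P: "?P \<in> ratfun_ring" by (simp add: ratfun_ring_power ratfun_ring_of_nat)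
  {
    assume "ratfun_pdvd k x"
    then obtain r where "r \<in> ratfun_ring" "x = ?P * r" by (auto simp: ratfun_pdvd_def)
    then show "of_nat CARD('p) ^ k dvd of_ratfun x"
      by (simp add: of_ratfun_mult P flip: of_nat_power_eq_of_ratfun)
  next
    assume "of_nat CARD('p) ^ k dvd of_ratfun x"
    then have "\<exists>y. of_ratfun x = of_ratfun ?P * y"
      by (auto simp: of_nat_power_eq_of_ratfun elim: dvdE)
    then show "ratfun_pdvd k x" using x P
    proof (transfer, goal_cases)
      case (1 x k)
      then obtain Y where Y: "ratfun_Cauchy Y" "ratfun_rel (\<lambda>_. x) (\<lambda>n. of_nat CARD('p) ^ k * Y n)"
        by (auto simp: Bex_def Respects_def ratfun_rel_refl)
      then obtain n where n: "ratfun_pdvd k (x - of_nat CARD('p) ^ k * Y n)"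
        unfolding ratfun_rel_def by blast
      have "Y n \<in> ratfun_ring" using Y(1) by (simp add: ratfun_Cauchy_def)
      then have "ratfun_pdvd k (of_nat CARD('p) ^ k * Y n)" unfolding ratfun_pdvd_def by blast
      from ratfun_pdvd_add[OF n this] show ?case by simp
    qed
  }
qed

text \<open>The quotients of X m - X N by p^k form a Cauchy sequence, and its class is the
  cofactor.\<close>

lemma abs_ratfun_completion_cong:
  fixes X :: "nat \<Rightarrow> 'p::prime_card ratfun"
  assumes X: "ratfun_Cauchy X" and k: "\<And>m. m \<ge> N \<Longrightarrow> ratfun_pdvd k (X m - X N)"
  shows "of_nat CARD('p) ^ k dvd abs_ratfun_completion X - of_ratfun (X N)"
proof -
  let ?P = "of_nat CARD('p) ^ k :: 'p ratfun"
  have P: "?P \<in> ratfun_ring" by (simp add: ratfun_ring_power ratfun_ring_of_nat)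
  have XR: "X n \<in> ratfun_ring" for n using X by (simp add: ratfun_Cauchy_def)
  from k obtain r where r: "\<And>m. m \<ge> N \<Longrightarrow> r m \<in> ratfun_ring \<and> X m - X N = ?P * r m"
    unfolding ratfun_pdvd_def by metis
  \<comment> \<open>Before N no quotient is available; the value 0 does not affect the
    class.\<close>
  define Y where "Y m = (if m \<ge> N then r m else 0)" for m
  have Y: "X m - X N = ?P * Y m" if "m \<ge> N" for m using r that by (simp add: Y_def)
  have YC: "ratfun_Cauchy Y"
    unfolding ratfun_Cauchy_def
  proof (intro conjI allI)
    show "Y n \<in> ratfun_ring" for n using r by (simp add: Y_def ratfun_ring_0)
    fix j
    \<comment> \<open>Dividing by p^k loses k digits, hence the precision k + j.\<close>
    obtain M where M: "\<And>m n. m \<ge> M \<Longrightarrow> n \<ge> M \<Longrightarrow> ratfun_pdvd (k + j) (X m - X n)"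
      using X unfolding ratfun_Cauchy_def by metis
    have "ratfun_pdvd j (Y m - Y n)" if "m \<ge> max M N" "n \<ge> max M N" for m n
    proof -
      have "X m - X n = (X m - X N) - (X n - X N)" by simp
      also have "\<dots> = ?P * (Y m - Y n)" using that by (simp add: Y right_diff_distrib)
      finally have "ratfun_pdvd (k + j) (?P * (Y m - Y n))" using M[of m n] that by simp
      then show ?thesis by (simp only: ratfun_pdvd_mult_power_iff)
    qed
    then show "\<exists>N. \<forall>m\<ge>N. \<forall>n\<ge>N. ratfun_pdvd j (Y m - Y n)" by blast
  qed
  have C: "ratfun_Cauchy (\<lambda>_. X N)" "ratfun_Cauchy (\<lambda>_. ?P)" "ratfun_Cauchy (\<lambda>n. ?P * Y n)"
    using ratfun_Cauchy_const XR P ratfun_Cauchy_mult[OF ratfun_Cauchy_const YC] by blast+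
  have "ratfun_rel X (\<lambda>n. X N + ?P * Y n)"
    unfolding ratfun_rel_def
  proof (intro conjI allI)
    show "\<exists>M. \<forall>n\<ge>M. ratfun_pdvd j (X n - (X N + ?P * Y n))" for j
    proof (intro exI[of _ N] allI impI)
      fix n assume "N \<le> n"
      then have "X n - (X N + ?P * Y n) = 0" using Y[of n] by (simp add: algebra_simps)
      then show "ratfun_pdvd j (X n - (X N + ?P * Y n))" by (simp only: ratfun_pdvd_0)
    qed
  qed (use X C ratfun_Cauchy_add in auto)
  then have "abs_ratfun_completion X = abs_ratfun_completion (\<lambda>n. X N + ?P * Y n)"
    by (rule Quotient_rel_abs[OF Quotient_ratfun_completion])
  also have "\<dots> = of_ratfun (X N) + of_ratfun ?P * abs_ratfun_completion Y"
    using C YC XR P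
    by (simp add: of_ratfun.abs_eq times_ratfun_completion.abs_eq plus_ratfun_completion.abs_eq
        ratfun_rel_refl)
  finally show ?thesis by (simp add: of_nat_power_eq_of_ratfun)
qed

lemma poly_fps_trunc_0: "0 < m \<Longrightarrow> poly (fps_trunc m f) 0 = fps_nth f 0"
  by (simp add: poly_0_coeff_0 coeff_fps_trunc)

text \<open>Both fractions expand to the Dwork series modulo p^n. The fraction f/g will be an
  earlier approximant, and later the binomial quotient.\<close>

lemma dwork_approx_pdvd:
  fixes b :: "'p::prime_card padic_int"
  assumes "of_nat CARD('p) ^ n dvd dwork_series b * fps_of_poly g - fps_of_poly f"
    and "\<not> of_nat CARD('p) dvd g" "0 < n" "n \<le> m"
  shows "ratfun_pdvd n (dwork_approx b m - Fract f g)"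
  unfolding dwork_approx_def
proof (rule ratfun_pdvd_Fract_diff[OF _ assms(1) _ assms(2)])
  have "of_nat CARD('p) ^ n dvd (of_nat CARD('p) ^ m :: 'p padic_int fps)"
    using assms(4) by (rule le_imp_power_dvd)
  then show "of_nat CARD('p) ^ n dvd
      dwork_series b * fps_of_poly (fps_trunc (CARD('p) ^ m) (dwork_denom b)) -
      fps_of_poly (fps_trunc (CARD('p) ^ m) (hyp_series b))"
    using dwork_congruence[of m b] assms(3,4) by (auto intro: dvd_trans)
  show "\<not> of_nat CARD('p) dvd fps_trunc (CARD('p) ^ m) (dwork_denom b)"
    using prime_gt_0_nat[OF prime_card[where 'a='p]]
    by (intro not_prime_dvd_poly) (simp add: poly_fps_trunc_0 dwork_denom_0)
qed

text \<open>The approximants are Cauchy and their class expands to the Dwork series, so by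
  \<open>has_expansion_unique\<close> it is the element described by \<open>dwork b\<close>.\<close>

lemma dwork_approx_cong:
  fixes b :: "'p::prime_card padic_int"
  assumes "0 < n"
  shows "of_nat CARD('p) ^ n dvd dwork b - of_ratfun (dwork_approx b n)"
proof -
  let ?p = "CARD('p)"
  let ?f = "\<lambda>n. fps_trunc (?p ^ n) (hyp_series b)" and ?g = "\<lambda>n. fps_trunc (?p ^ n) (dwork_denom b)"
  have g: "poly (?g n) 0 = 1" for n
    using prime_gt_0_nat[OF prime_card[where 'a='p]] by (simp add: poly_fps_trunc_0 dwork_denom_0)
  have pdvd: "ratfun_pdvd n (dwork_approx b m - dwork_approx b n)" if "0 < n" "n \<le> m" for m n
    unfolding dwork_approx_def[of b n]
    using dwork_congruence[OF that(1)] not_prime_dvd_poly[OF g] that by (rule dwork_approx_pdvd)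
  have "ratfun_Cauchy (dwork_approx b)"
    unfolding ratfun_Cauchy_def
  proof (intro conjI allI)
    show "dwork_approx b n \<in> ratfun_ring" for n by (rule dwork_approx_ring)
    fix k
    \<comment> \<open>The congruence is available for positive exponents, so the argument runs at
      Suc k and then drops to k.\<close>
    have "ratfun_pdvd (Suc k) (dwork_approx b m - dwork_approx b n)"
      if "m \<ge> Suc k" "n \<ge> Suc k" for m n
      using ratfun_pdvd_add[OF pdvd[of "Suc k" m] ratfun_pdvd_uminus[OF pdvd[of "Suc k" n]]] that
      by simp
    moreover have "ratfun_pdvd k x" if Suc: "ratfun_pdvd (Suc k) x" for x :: "'p ratfun"
    proof -
      obtain r where r: "r \<in> ratfun_ring" "x = of_nat ?p ^ k * (of_nat ?p * r)"
        using Suc unfolding ratfun_pdvd_def power_Suc2 by (auto simp: mult.assoc)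
      then show ?thesis
        unfolding ratfun_pdvd_def using r(2) ratfun_ring_mult[OF ratfun_ring_of_nat r(1)] by blast
    qed
    ultimately show "\<exists>N. \<forall>m\<ge>N. \<forall>n\<ge>N. ratfun_pdvd k (dwork_approx b m - dwork_approx b n)"
      by blast
  qed
  from abs_ratfun_completion_cong[OF this] pdvd
  have lim: "of_nat ?p ^ n dvd abs_ratfun_completion (dwork_approx b) - of_ratfun (dwork_approx b n)"
    if "0 < n" for n
    using that by blast
  have "has_expansion (abs_ratfun_completion (dwork_approx b)) (dwork_series b)"
    unfolding has_expansion_def
  proof
    fix n
    have 1: "of_nat ?p ^ n dvd (of_nat ?p ^ Suc n :: 'p ratfun_completion)"
      and 2: "of_nat ?p ^ n dvd (of_nat ?p ^ Suc n :: 'p padic_int fps)"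
      by (simp_all only: le_imp_power_dvd lessI less_imp_le)
    have "of_nat ?p ^ n dvd
        abs_ratfun_completion (dwork_approx b) - of_ratfun (Fract (?f (Suc n)) (?g (Suc n)))"
      using dvd_trans[OF 1 lim[of "Suc n"]] by (simp only: dwork_approx_def)
    moreover have "of_nat ?p ^ n dvd
        dwork_series b * fps_of_poly (?g (Suc n)) - fps_of_poly (?f (Suc n))"
      using dvd_trans[OF 2 dwork_congruence[of "Suc n" b]] by simp
    moreover have "poly (?g (Suc n)) 0 dvd 1" by (simp only: g dvd_refl)
    ultimately show "\<exists>f g. poly g 0 dvd 1 \<and>
        of_nat ?p ^ n dvd abs_ratfun_completion (dwork_approx b) - of_ratfun (Fract f g) \<and>
        of_nat ?p ^ n dvd dwork_series b * fps_of_poly g - fps_of_poly f"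
      by blast
  qed
  then have "dwork b = abs_ratfun_completion (dwork_approx b)"
    unfolding dwork_def by (intro the_equality) (auto intro: has_expansion_unique)
  with lim[OF assms] show ?thesis by simp
qed

section \<open>Substitution of 1/t for t\<close>

lemma comm_ring_hom_const_poly_fract:
  "map_poly_comm_ring_hom (\<lambda>c :: 'a::idom. to_fract [:c:])"
  by unfold_locales (simp_all add: one_pCons[symmetric] flip: to_fract_add to_fract_mult)

lemma poly_at_inverse_diff: "poly_at_inverse (f - g) = poly_at_inverse f - poly_at_inverse g"
proof -
  interpret map_poly_comm_ring_hom "\<lambda>c :: 'a. to_fract [:c:]"
    by (rule comm_ring_hom_const_poly_fract)
  show ?thesis by (simp add: poly_at_inverse_def hom_minus)
qed

lemma poly_at_inverse_of_nat: "poly_at_inverse (of_nat n) = of_nat n"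
proof -
  interpret map_poly_comm_ring_hom "\<lambda>c :: 'a. to_fract [:c:]"
    by (rule comm_ring_hom_const_poly_fract)
  show ?thesis by (simp add: poly_at_inverse_def hom_of_nat)
qed

lemma poly_at_inverse_power: "poly_at_inverse (f ^ n :: 'a::idom poly) = poly_at_inverse f ^ n"
  using poly_at_inverse_of_nat[of 1, where 'a='a]
  by (induction n) (simp_all only: of_nat_1 power_0 power_Suc poly_at_inverse_mult)

lemma poly_at_inverse_X: "poly_at_inverse [:0, 1:] = inverse (to_fract [:0, 1:])"
  by (simp add: poly_at_inverse_def map_poly_pCons flip: one_pCons)

lemma ratfun_invert_diff: "ratfun_invert (x - y) = ratfun_invert x - ratfun_invert y"
proof (cases x, cases y)
  fix f g f' g' assume "x = Fract f g" "g \<noteq> 0" "y = Fract f' g'" "g' \<noteq> 0"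
  then show ?thesis
    by (simp add: ratfun_invert_Fract poly_at_inverse_diff poly_at_inverse_mult
        poly_at_inverse_eq_0_iff diff_frac_eq mult.commute)
qed

lemma ratfun_invert_of_nat_power_mult:
  "ratfun_invert (of_nat n ^ k * x) = of_nat n ^ k * ratfun_invert x"
proof (cases x)
  fix f g assume x: "x = Fract f g" "g \<noteq> 0"
  have "of_nat n ^ k * x = Fract (of_nat (n ^ k)) 1 * x"
    unfolding Fract_of_nat_eq by simp
  also have "\<dots> = Fract (of_nat n ^ k * f) g" by (simp add: x)
  finally show ?thesis
    using x by (simp add: ratfun_invert_Fract poly_at_inverse_mult poly_at_inverse_power
        poly_at_inverse_of_nat)
qed

text \<open>The substitution fixes p and preserves \<open>ratfun_ring\<close>; hence it is
  p-adically continuous.\<close>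

lemma ratfun_pdvd_invert: "ratfun_pdvd k x \<Longrightarrow> ratfun_pdvd k (ratfun_invert x)"
  unfolding ratfun_pdvd_def using ratfun_invert_ring ratfun_invert_of_nat_power_mult by metis

lemma to_fract_power: "to_fract (f ^ n) = to_fract f ^ n"
  by (induction n) (simp_all add: to_fract_mult)

text \<open>The substitution turns 1 - t into -(1 - t)/t and 1 - t^p into -(1 - t^p)/t^p.\<close>

lemma ratfun_invert_binomial_quotient:
  fixes t :: "'a::idom poly fract" and l m p :: nat
  defines "t \<equiv> to_fract [:0, 1:]"
  assumes p: "0 < p"
  defines "R \<equiv> Fract ((1 - [:0, 1:]) ^ (l + p * m)) ((1 - [:0, 1:] ^ p) ^ m)"
  shows "(- t) ^ l * ratfun_invert R = (- 1) ^ (Suc p * m) * R"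
proof -
  let ?X = "[:0, 1:] :: 'a poly"
  have t: "t \<noteq> 0" by (simp add: t_def)
  have nz: "1 - ?X ^ p \<noteq> 0"
  proof
    assume "1 - ?X ^ p = 0"
    then have "poly (1 - ?X ^ p) 0 = 0" by simp
    then show False using p by (simp add: power_0_left)
  qed
  then have nz': "1 - t ^ p \<noteq> 0"
    unfolding t_def by (metis to_fract_1 to_fract_diff to_fract_eq_0_iff to_fract_power)
  have R: "R = (1 - t) ^ (l + p * m) / (1 - t ^ p) ^ m"
    unfolding R_def t_def Fract_conv_to_fract
    by (simp only: to_fract_power to_fract_diff to_fract_1)
  have "ratfun_invert R = (1 - inverse t) ^ (l + p * m) / (1 - inverse t ^ p) ^ m"
    unfolding R_def t_def using nz poly_at_inverse_of_nat[of 1, where 'a='a]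
    by (simp add: ratfun_invert_Fract poly_at_inverse_power poly_at_inverse_diff poly_at_inverse_X)
  also have "1 - inverse t = - 1 * (1 - t) / t" using t by (simp add: field_simps)
  also have "1 - inverse t ^ p = - 1 * (1 - t ^ p) / t ^ p" using t by (simp add: field_simps)
  \<comment> \<open>The denominators contribute t^(l + p m) and t^(p m), so exactly t^l
    remains.\<close>
  also have "(- 1 * (1 - t) / t) ^ (l + p * m) / (- 1 * (1 - t ^ p) / t ^ p) ^ m =
      (- 1) ^ (l + p * m) / (- 1) ^ m * R / t ^ l"
    unfolding power_divide power_mult_distrib R
    using t nz' by (simp add: power_add divide_simps flip: power_mult)
  also have "(- 1) ^ (l + p * m) / (- 1) ^ m = ((- 1) ^ (l + p * m + m) :: 'a poly fract)"
    by (simp add: minus_one_power_iff)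
  finally have "(- t) ^ l * ratfun_invert R = (- 1) ^ (l + (l + p * m + m)) * R"
    using t by (simp add: power_minus[of t] power_add)
  also have "l + (l + p * m + m) = 2 * l + Suc p * m" by simp
  finally show ?thesis by (simp add: power_add power_mult)
qed

section \<open>The inversion formula\<close>

lemma dwork_approx_pdvd_binomial_quotient:
  fixes b :: "'p::prime_card padic_int"
  assumes "of_nat CARD('p) ^ n dvd dwork_prime b + of_nat m" "0 < n"
  defines "g \<equiv> (1 - [:0, 1:] ^ CARD('p)) ^ m"
  defines "R \<equiv> Fract ((1 - [:0, 1:]) ^ (dwork_digit b + CARD('p) * m)) g"
  shows "R \<in> ratfun_ring" "ratfun_pdvd n (dwork_approx b n - R)"
proof -
  have "poly g 0 = 1"
    using prime_gt_0_nat[OF prime_card[where 'a='p]] by (simp add: g_def power_0_left)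
  then have g: "\<not> of_nat CARD('p) dvd g" by (rule not_prime_dvd_poly)
  then show "R \<in> ratfun_ring" unfolding R_def by (rule ratfun_ringI)
  have X: "fps_of_poly [:0, 1 :: 'p padic_int:] = fps_X"
    by (simp add: fps_of_poly_pCons)
  show "ratfun_pdvd n (dwork_approx b n - R)"
    unfolding R_def
    by (rule dwork_approx_pdvd[OF _ g assms(2) order.refl])
      (use dwork_series_cong_power[OF assms(1)] in
        \<open>simp add: g_def fps_of_poly_power fps_of_poly_diff X\<close>)
qed

text \<open>For odd p the first factor is even; for p = 2 all residues of x at positive levels have
  the same parity. Thus the sign at level n is independent of n and survives the limit.\<close>

lemma prime_parity_residue:
  fixes x :: "'p::prime_card padic_int"
  assumes "0 < n"
  shows "even (Suc CARD('p) * nat (Rep_padic_int x n)) \<longleftrightarrow>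
    even (Suc CARD('p) * nat (Rep_padic_int x 1))"
proof (cases "odd CARD('p)")
  case False
  then have "\<not> 2 < CARD('p)" using prime_odd_nat[OF prime_card[where 'a='p]] by blast
  with prime_ge_2_nat[OF prime_card[where 'a='p]] have "CARD('p) = 2" by linarith
  then have "Rep_padic_int x n mod 2 = Rep_padic_int x 1"
    using padic_mod_le[of 1 n x] assms by simp
  then have "even (Rep_padic_int x n) \<longleftrightarrow> even (Rep_padic_int x 1)"
    by (metis mod_mod_trivial even_iff_mod_2_eq_zero)
  then show ?thesis using False padic_bounds(1)[of x] by (simp add: even_nat_iff)
qed simp

text \<open>As the image of t under the substitution, 1/t lies in
  \<open>ratfun_ring\<close>.\<close>

lemma completion_t_inverse:
  "completion_t * of_ratfun (inverse (to_fract [:0, 1:])) = (1 :: 'p::prime_card ratfun_completion)"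
  "inverse (to_fract [:0, 1:]) \<in> (ratfun_ring :: 'p ratfun set)"
proof -
  have "ratfun_invert (to_fract [:0, 1:]) =
      poly_at_inverse [:0, 1:] / (poly_at_inverse 1 :: 'p ratfun)"
    unfolding to_fract_def by (rule ratfun_invert_Fract) simp
  also have "\<dots> = inverse (to_fract [:0, 1:])"
    using poly_at_inverse_of_nat[of 1, where 'a = "'p padic_int"] by (simp add: poly_at_inverse_X)
  finally have "ratfun_invert (to_fract [:0, 1:]) = inverse (to_fract [:0, 1:] :: 'p ratfun)" .
  moreover have t: "to_fract [:0, 1:] \<in> (ratfun_ring :: 'p ratfun set)"
    unfolding to_fract_def by (rule ratfun_ring_poly)
  ultimately show inv: "inverse (to_fract [:0, 1:]) \<in> (ratfun_ring :: 'p ratfun set)"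
    using ratfun_invert_ring by metis
  have "to_fract [:0, 1:] * inverse (to_fract [:0, 1:]) = (1 :: 'p ratfun)" by simp
  then show "completion_t * of_ratfun (inverse (to_fract [:0, 1:])) = (1 :: 'p ratfun_completion)"
    unfolding completion_t_def to_fract_def[symmetric]
    by (simp add: t inv of_ratfun_1 flip: of_ratfun_mult)
qed

text \<open>At level n the approximant is congruent to the binomial quotient \<open>R\<close>, on
  which the substitution is multiplication by \<open>u\<close>. Continuity carries this over to the
  approximants and then to the limit.\<close>

lemma dwork_inv_eq:
  fixes b :: "'p::prime_card padic_int"
  defines "e \<equiv> Suc CARD('p) * nat (Rep_padic_int (- dwork_prime b) 1)"
  shows "dwork_inv b =
    (- 1) ^ e * (- of_ratfun (inverse (to_fract [:0, 1:]))) ^ dwork_digit b * dwork b"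
  unfolding dwork_inv_def
proof (rule padic_lim_eq, unfold padic_converges_def, intro allI exI impI)
  fix k n assume n: "Suc k \<le> n"
  let ?p = "CARD('p)" and ?l = "dwork_digit b" and ?X = "dwork_approx b n"
  define t where "t = (to_fract [:0, 1:] :: 'p ratfun)"
  define m where "m = nat (Rep_padic_int (- dwork_prime b) n)"
  define R where "R = (Fract ((1 - [:0, 1:]) ^ (?l + ?p * m)) ((1 - [:0, 1:] ^ ?p) ^ m) :: 'p ratfun)"
  define u where "u = (- 1) ^ e * (- inverse t) ^ ?l"
  have p: "0 < ?p" using prime_gt_0_nat[OF prime_card] .
  have tR: "- inverse t \<in> ratfun_ring"
    unfolding t_def by (rule ratfun_ring_uminus[OF completion_t_inverse(2)])
  have one: "- 1 \<in> (ratfun_ring :: 'p ratfun set)" by (rule ratfun_ring_uminus[OF ratfun_ring_1])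
  have u: "u \<in> ratfun_ring"
    unfolding u_def using tR one by (intro ratfun_ring_mult ratfun_ring_power)
  have "of_nat ?p ^ n dvd dwork_prime b + of_nat m"
    using padic_residue_nat_dvd[of n "- dwork_prime b"]
    by (simp add: m_def algebra_simps flip: dvd_minus_iff[of _ "- dwork_prime b - _"])
  note R = dwork_approx_pdvd_binomial_quotient[OF this, folded R_def]
  have "(- 1) ^ e = ((- 1) ^ (Suc ?p * m) :: 'p ratfun)"
    using prime_parity_residue[of n "- dwork_prime b"] n
    unfolding e_def m_def minus_one_power_iff by simp
  then have "u * R = (- inverse t) ^ ?l * ((- t) ^ ?l * ratfun_invert R)"
    using ratfun_invert_binomial_quotient[OF p, of ?l m, where 'a = "'p padic_int"]
    unfolding u_def R_def t_def by (simp only: mult_ac)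
  also have "\<dots> = ratfun_invert R"
    by (simp add: t_def mult.assoc[symmetric] flip: power_mult_distrib)
  \<comment> \<open>Subtracting the exact identity for \<open>R\<close> expresses the error through
    the small difference \<open>?X - R\<close>.\<close>
  finally have "ratfun_invert ?X - u * ?X = ratfun_invert (?X - R) - u * (?X - R)"
    by (simp add: ratfun_invert_diff algebra_simps)
  moreover have "ratfun_pdvd n (ratfun_invert (?X - R))" "ratfun_pdvd n (u * (?X - R))"
    using R n u by (auto intro: ratfun_pdvd_invert ratfun_pdvd_mult')
  ultimately have "ratfun_pdvd n (ratfun_invert ?X - u * ?X)"
    using ratfun_pdvd_add ratfun_pdvd_uminus by (metis uminus_add_conv_diff add.commute)
  moreover have R': "ratfun_invert ?X \<in> ratfun_ring" "u * ?X \<in> ratfun_ring"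
    using dwork_approx_ring[of b n] u by (auto intro: ratfun_invert_ring ratfun_ring_mult)
  ultimately have 1: "of_nat ?p ^ n dvd of_ratfun (ratfun_invert ?X) - of_ratfun (u * ?X)"
    by (simp add: of_nat_power_dvd_of_ratfun_iff ratfun_ring_diff flip: of_ratfun_diff)
  have 2: "of_nat ?p ^ n dvd of_ratfun u * (dwork b - of_ratfun ?X)"
    using dwork_approx_cong[of n b] n by simp
  have 3: "of_nat ?p ^ n dvd of_ratfun (ratfun_invert ?X) - of_ratfun u * dwork b"
    using dvd_diff[OF 1 2] u dwork_approx_ring[of b n] by (simp add: of_ratfun_mult algebra_simps)
  have 4: "of_ratfun u = (- 1) ^ e * (- of_ratfun (inverse t)) ^ ?l"
    using tR one completion_t_inverse(2)[where 'p='p]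
    by (simp add: u_def t_def of_ratfun_mult of_ratfun_power of_ratfun_uminus ratfun_ring_power
        ratfun_ring_1 of_ratfun_1)
  have 5: "of_nat ?p ^ k dvd (of_nat ?p ^ n :: 'p ratfun_completion)"
    using n by (intro le_imp_power_dvd) simp
  show "of_nat ?p ^ k dvd of_ratfun (ratfun_invert ?X) -
      (- 1) ^ e * (- of_ratfun (inverse (to_fract [:0, 1:]))) ^ ?l * dwork b"
    using dvd_trans[OF 5 3] by (simp only: 4 t_def)
qed

lemma dwork_inversion:
  fixes b :: "'p::prime_card padic_int"
  shows "dwork b = (- 1) ^ (Suc CARD('p) * nat (Rep_padic_int (- dwork_prime b) 1)) *
    (- completion_t) ^ dwork_digit b * dwork_inv b"
proof -
  let ?s = "of_ratfun (inverse (to_fract [:0, 1:])) :: 'p ratfun_completion"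
  let ?e = "(- 1) ^ (Suc CARD('p) * nat (Rep_padic_int (- dwork_prime b) 1)) :: 'p ratfun_completion"
  have "?e * ?e = 1" by (simp add: minus_one_power_iff)
  moreover have "(- completion_t) ^ dwork_digit b * (- ?s) ^ dwork_digit b = 1"
    by (simp add: completion_t_inverse(1) flip: power_mult_distrib)
  ultimately have "(?e * ?e) * ((- completion_t) ^ dwork_digit b * (- ?s) ^ dwork_digit b) * dwork b = dwork b"
    by simp
  then show ?thesis unfolding dwork_inv_eq by (simp only: mult_ac)
qed

text \<open>This separates the two signs when p = 2. The numerator of every approximant has constant
  term 1, so p cannot divide an approximant.\<close>

lemma prime_mult_dwork_nonzero:
  fixes b :: "'p::prime_card padic_int"
  shows "of_nat CARD('p) * dwork b \<noteq> 0"
proof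
  let ?p = "CARD('p)" and ?X = "dwork_approx b 2"
  let ?f = "fps_trunc (?p ^ 2) (hyp_series b)" and ?g = "fps_trunc (?p ^ 2) (dwork_denom b)"
  assume 0: "of_nat ?p * dwork b = 0"
  have p: "0 < ?p" using prime_gt_0_nat[OF prime_card] .
  have "of_nat ?p ^ 2 dvd of_nat ?p * (dwork b - of_ratfun ?X)"
    using dwork_approx_cong[of 2 b] by simp
  then have "of_nat ?p ^ 2 dvd of_nat ?p * of_ratfun ?X"
    using 0 by (simp add: right_diff_distrib)
  then have "of_nat ?p ^ 2 dvd of_ratfun (of_nat ?p ^ 1 * ?X)"
    using dwork_approx_ring[of b 2]
    by (simp add: of_ratfun_mult ratfun_ring_of_nat of_ratfun_of_nat)
  then have "ratfun_pdvd (1 + 1) (of_nat ?p ^ 1 * ?X)"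
    using dwork_approx_ring[of b 2]
    by (subst (asm) of_nat_power_dvd_of_ratfun_iff)
      (simp_all add: ratfun_ring_mult ratfun_ring_of_nat numeral_2_eq_2)
  \<comment> \<open>Working modulo p^2 leaves one factor p after this cancellation.\<close>
  then have "ratfun_pdvd 1 ?X" by (simp only: ratfun_pdvd_mult_power_iff)
  then obtain r where r: "?X = of_nat ?p * r" "r \<in> ratfun_ring" by (auto simp: ratfun_pdvd_def)
  from r(2) obtain f g where fg: "r = Fract f g" and g: "\<not> of_nat ?p dvd g" "g \<noteq> 0"
    by (rule ratfun_ring_cases)
  have X: "?X = of_nat ?p * Fract f g" using r(1) fg by simp
  have "poly ?g 0 = 1" and f0: "poly ?f 0 = 1"
    using p by (simp_all add: poly_fps_trunc_0 dwork_denom_0)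
  then have "?g \<noteq> 0" by auto
  have "Fract ?f ?g = Fract (of_nat ?p * f) g"
    using X by (simp add: dwork_approx_def flip: Fract_of_nat_eq)
  then have "?f * g = of_nat ?p * (f * ?g)"
    using g(2) \<open>?g \<noteq> 0\<close> by (simp add: eq_fract mult.assoc)
  then have "of_nat ?p dvd ?f * g" by simp
  then show False
    using g(1) not_prime_dvd_poly[OF f0] prime_elem_dvd_mult_iff[OF prime_elem_padic_poly]
    by blast
qed

theorem theorem4p4:
  fixes a :: "'p::prime_card padic_int" and l :: nat
  assumes "l < CARD('p)"
    and "of_nat CARD('p) dvd a + of_nat l"
  shows "(odd CARD('p) \<longrightarrow> dwork a = (- completion_t) ^ l * dwork_inv a) \<and>
    (CARD('p) = 2 \<longrightarrow>
      (\<exists>\<epsilon>\<in>{1, -1}. dwork a = \<epsilon> * (- completion_t) ^ l * dwork_inv a)) \<and>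
    (CARD('p) = 2 \<longrightarrow>
      dwork (1 :: 'p padic_int) = - (- completion_t) * dwork_inv 1 \<and>
      - (- completion_t) * dwork_inv (1 :: 'p padic_int) \<noteq> (- completion_t) * dwork_inv 1)"
proof (intro conjI impI)
  have inv: "dwork a = (- 1) ^ (Suc CARD('p) * nat (Rep_padic_int (- dwork_prime a) 1)) *
      (- completion_t) ^ l * dwork_inv a"
    using dwork_inversion[of a] dwork_digit_eqI[OF assms] by simp
  then show "odd CARD('p) \<Longrightarrow> dwork a = (- completion_t) ^ l * dwork_inv a"
    by (simp add: power_mult)
  show "\<exists>\<epsilon>\<in>{1, -1}. dwork a = \<epsilon> * (- completion_t) ^ l * dwork_inv a"
    using inv by (auto simp: minus_one_power_iff simp del: mult_Suc split: if_splits)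
next
  assume two: "CARD('p) = 2"
  have l: "dwork_digit (1 :: 'p padic_int) = 1"
    using two by (intro dwork_digit_eqI) simp_all
  have "of_nat CARD('p) * dwork_prime (1 :: 'p padic_int) = of_nat CARD('p) * 1"
    using mult_dwork_prime[of "1 :: 'p padic_int"] by (simp add: l two)
  then have b: "dwork_prime (1 :: 'p padic_int) = 1" by (simp only: mult_cancel_left) (simp add: two)
  \<comment> \<open>The Dwork prime of 1 is 1, so the sign exponent is 3 times this residue, which
    is odd.\<close>
  have "Rep_padic_int (- 1 :: 'p padic_int) 1 = 1"
    by (simp add: uminus_padic_int.rep_eq one_padic_int.rep_eq two)
  then show eq: "dwork (1 :: 'p padic_int) = - (- completion_t) * dwork_inv 1"
    using dwork_inversion[of "1 :: 'p padic_int"] by (simp add: l b two)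
  show "- (- completion_t) * dwork_inv (1 :: 'p padic_int) \<noteq> (- completion_t) * dwork_inv 1"
  proof
    assume "- (- completion_t) * dwork_inv (1 :: 'p padic_int) = (- completion_t) * dwork_inv 1"
    \<comment> \<open>Equality of the two sides would make \<open>dwork 1\<close> equal to its
      negative.\<close>
    then have "of_nat CARD('p) * dwork (1 :: 'p padic_int) = 0"
      by (simp add: eq two)
    then show False using prime_mult_dwork_nonzero by blast
  qed
qed

end
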